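(* Let $\Sigma$ be a finite alphabet and let $\mathbf{a} = (a(n))_{n \in \mathbb{Z}}$ be a two-sided bracket word over $\Sigma$. Let $f \colon \mathbb{R}_+ \to \mathbb{R}$ be a Hardy field function with polynomial growth (take a representative of its germ defined on $[0,\infty)$). Let $p(H)$ denote the number of distinct words $w \in \Sigma^H$ of the form $(a(\lfloor f(N)\rfloor), a(\lfloor f(N+1)\rfloor),\dots,a(\lfloor f(N+H-1)\rfloor))$ with $N \in \mathbb{N}_0$ (the subword complexity of $(a(\lfloor f(n)\rfloor))_{n=0}^\infty$). Then there exist $0<\delta<1$ and $C>0$ such that $p(H) \le \exp(C H^{\delta})$ for all $H \in \mathbb{N}$.
   Context: A generalised polynomial (gp) map $\mathbb{R}^d \to \mathbb{R}$ is an element of the smallest family of maps containing all polynomial maps and closed under pointwise addition, pointwise multiplication and taking the integer part $\lfloor\cdot\rfloor$ pointwise; a gp map $\mathbb{Z}\to\mathbb{R}$ is the restriction to $\mathbb{Z}$ of a gp map $\mathbb{R}\to\mathbb{R}$. A (two-sided) bracket word over a finite alphabet $\Sigma$ is a sequence $a\colon\mathbb{Z}\to\Sigma$ of the form $a = \pi\circ g$, where $g\colon \mathbb{Z}\to\mathbb{R}$ is a finitely-valued gp map and $\pi$ is a map from the (finite) range of $g$ to $\Sigma$ (a letter-to-letter coding). A Hardy field is a subfield of the ring of germs at $+\infty$ of real-valued functions defined on half-lines $(c,\infty)$, closed under differentiation; a Hardy field function is an element of some Hardy field. Such $f$ has polynomial growth if $f(t)/t^n \to 0$ as $t\to\infty$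 for some $n\in\mathbb{N}$. *)

theory Defs
  imports Complex_Main "HOL-Computational_Algebra.Polynomial"
begin

inductive gp :: "(real \<Rightarrow> real) \<Rightarrow> bool" where
  gp_poly: "gp (\<lambda>x. poly p x)"
| gp_add: "gp f \<Longrightarrow> gp g \<Longrightarrow> gp (\<lambda>x. f x + g x)"
| gp_mult: "gp f \<Longrightarrow> gp g \<Longrightarrow> gp (\<lambda>x. f x * g x)"
| gp_floor: "gp f \<Longrightarrow> gp (\<lambda>x. of_int \<lfloor>f x\<rfloor>)"

definition bracket_word :: "(int \<Rightarrow> 'a) \<Rightarrow> bool" where
  "bracket_word a \<longleftrightarrow>
     (\<exists>g \<pi>. gp g \<and> finite (range (\<lambda>n::int. g (of_int n)))
            \<and> (\<forall>n. a n = \<pi> (g (of_int n))))"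

text \<open>Hardy field: a set of representatives of germs at +infinity forming a subfield of
  the ring of germs, closed under differentiation (all operations up to eventual equality).\<close>
definition hardy_field :: "(real \<Rightarrow> real) set \<Rightarrow> bool" where
  "hardy_field F \<longleftrightarrow>
     (\<exists>z\<in>F. \<forall>\<^sub>F x in at_top. z x = 0) \<and>
     (\<exists>u\<in>F. \<forall>\<^sub>F x in at_top. u x = 1) \<and>
     (\<forall>f\<in>F. \<forall>g\<in>F. \<exists>h\<in>F. \<forall>\<^sub>F x in at_top. h x = f x + g x) \<and>
     (\<forall>f\<in>F. \<exists>h\<in>F. \<forall>\<^sub>F x in at_top. h x = - f x) \<and>
     (\<forall>f\<in>F. \<forall>g\<in>F. \<exists>h\<in>F. \<forall>\<^sub>F x in at_top. h x = f x * g x) \<and>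
     (\<forall>f\<in>F. \<not> (\<forall>\<^sub>F x in at_top. f x = 0) \<longrightarrow>
              (\<exists>h\<in>F. \<forall>\<^sub>F x in at_top. f x * h x = 1)) \<and>
     (\<forall>f\<in>F. \<exists>h\<in>F. \<forall>\<^sub>F x in at_top. (f has_real_derivative h x) (at x))"

definition hardy_field_function :: "(real \<Rightarrow> real) \<Rightarrow> bool" where
  "hardy_field_function f \<longleftrightarrow>
     (\<exists>F. hardy_field F \<and> (\<exists>g\<in>F. \<forall>\<^sub>F x in at_top. f x = g x))"

definition polynomial_growth :: "(real \<Rightarrow> real) \<Rightarrow> bool" where
  "polynomial_growth f \<longleftrightarrow> (\<exists>n::nat. ((\<lambda>t. f t / t ^ n) \<longlongrightarrow> 0) at_top)"

definition subword_complexity :: "(nat \<Rightarrow> 'a) \<Rightarrow> nat \<Rightarrow> nat" where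
  "subword_complexity b H = card {map (\<lambda>i. b (N + i)) [0..<H] | N. True}"

end

theory Submission
  imports Defs
begin

text \<open>
  Call a function on \<open>{..<H}\<close> structured if \<open>{..<H}\<close> is covered by \<open>O(H\<^sup>1\<^sup>-\<^sup>\<eta>)\<close> arithmetic progressions of
  length \<open>O(H\<^sup>\<eta>)\<close>, on each of which it is a polynomial of bounded degree. Structured functions are closed
  under sums and products, by refining one covering along the other. They are also closed under floors:
  by the Weyl--Heilbronn theorem (some \<open>q \<le> Q\<close> has \<open>q\<^sup>d \<alpha>\<close> within \<open>Q\<^sup>-\<^sup>c\<close> of an integer), applied to one
  coefficient after the other, a polynomial restricted to suitable progressions is an integer-valued
  polynomial plus a bounded one, and the floor of the latter is constant on boundedly many intervals.
  Hence a generalised polynomial evaluated along a polynomial is structured, uniformly in the coefficients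
  of the latter.

  For \<open>N\<close> larger than a power of \<open>H\<close>, the function \<open>f(N + h)\<close>, \<open>h < H\<close>, is a polynomial plus a bounded
  function, and a high derivative of \<open>f\<close> has constant sign, so by Rolle the integer parts are structured too.
  A finitely-valued polynomial is constant on a long progression. So every word is constant on the members
  of a covering by \<open>O(H\<^sup>1\<^sup>-\<^sup>\<eta>)\<close> progressions, and there are only \<open>exp(O(H\<^sup>1\<^sup>-\<^sup>\<eta> log H))\<close> such words; the words
  with small \<open>N\<close> are polynomially many.
\<close>

section \<open>Distance to the nearest integer and exponential sums\<close>

text \<open>The starting point N is unbounded, so the Taylor polynomials have arbitrary real
  coefficients and every covering must have exponent and constants that depend on degrees alone.
  This is what calls for Heilbronn's theorem with power bounds. Passing to step q multiplies the
  coefficient of degree d by q^d, and an approximation of q \<alpha> from Dirichlet's theorem would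
  be spoilt by the factor q^(d-1); moreover q has to be small against H to leave few progressions.
  The integer parts are unbounded as well, so constancy cannot be asked for before the end. The
  invariant is a polynomial of bounded degree on each progression, and the finite range of g enters
  only in the last refinement. For the integer part of a bounded smooth remainder, size is not
  enough: the remainder could cross an integer level arbitrarily often. A fixed sign of the
  derivative of order d + 1 excludes this and is unaffected by subtracting polynomials of degree at
  most d; Hardy fields provide it. Exponents are never optimised, only their independence of H and N
  matters.\<close>

definition dist_int :: "real \<Rightarrow> real" where
  "dist_int x = \<bar>x - of_int (round x)\<bar>"

lemma dist_int_le: "dist_int x \<le> \<bar>x - of_int m\<bar>"
  unfolding dist_int_def by (rule round_diff_minimal)

lemma dist_int_nonneg [simp]: "0 \<le> dist_int x"
  by (simp add: dist_int_def)

lemma dist_int_le_half: "dist_int x \<le> 1/2"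
  unfolding dist_int_def using of_int_round_abs_le[of x] by (simp add: abs_minus_commute)

lemma dist_int_obtain: obtains m :: int where "dist_int x = \<bar>x - of_int m\<bar>"
  by (auto simp: dist_int_def)

lemma dist_int_mult_nat: "dist_int (real k * x) \<le> real k * dist_int x"
proof -
  obtain m :: int where m: "dist_int x = \<bar>x - of_int m\<bar>" by (rule dist_int_obtain)
  have "dist_int (real k * x) \<le> \<bar>real k * x - of_int (int k * m)\<bar>" by (rule dist_int_le)
  also have "\<dots> = \<bar>real k * (x - of_int m)\<bar>" by (simp add: algebra_simps)
  also have "\<dots> = real k * dist_int x" by (simp add: m abs_mult)
  finally show ?thesis .
qed

lemma dist_int_diff: "dist_int (x - y) \<le> dist_int x + dist_int y"
proof -
  obtain m :: int where m: "dist_int x = \<bar>x - of_int m\<bar>" by (rule dist_int_obtain)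
  obtain n :: int where n: "dist_int y = \<bar>y - of_int n\<bar>" by (rule dist_int_obtain)
  have "dist_int (x - y) \<le> \<bar>x - y - of_int (m - n)\<bar>" by (rule dist_int_le)
  also have "\<dots> \<le> dist_int x + dist_int y" unfolding m n by simp
  finally show ?thesis .
qed

lemma dist_int_add_int: "dist_int (x + of_int m) = dist_int x"
proof (rule antisym)
  have *: "dist_int (x + of_int m) \<le> dist_int x" for x m
  proof -
    obtain n :: int where n: "dist_int x = \<bar>x - of_int n\<bar>" by (rule dist_int_obtain)
    have "dist_int (x + of_int m) \<le> \<bar>x + of_int m - of_int (n + m)\<bar>" by (rule dist_int_le)
    thus ?thesis by (simp add: n)
  qed
  show "dist_int (x + of_int m) \<le> dist_int x" by (rule *)
  show "dist_int x \<le> dist_int (x + of_int m)" using *[of "x + of_int m" "-m"] by simp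
qed

lemma dist_int_small: "\<bar>x\<bar> \<le> 1/2 \<Longrightarrow> dist_int x = \<bar>x\<bar>"
proof (rule antisym)
  show "dist_int x \<le> \<bar>x\<bar>" using dist_int_le[of x 0] by simp
  assume x: "\<bar>x\<bar> \<le> 1/2"
  obtain m :: int where m: "dist_int x = \<bar>x - of_int m\<bar>" by (rule dist_int_obtain)
  show "\<bar>x\<bar> \<le> dist_int x"
  proof (cases "m = 0")
    case False
    hence "1 \<le> \<bar>m\<bar>" by linarith
    hence "1 \<le> \<bar>real_of_int m\<bar>" by (metis of_int_1_le_iff of_int_abs)
    thus ?thesis using x m by linarith
  qed (simp add: m)
qed

lemma dist_int_minus [simp]: "dist_int (- x) = dist_int x"
  using dist_int_diff[of 0 x] dist_int_diff[of 0 "-x"] dist_int_small[of 0] by simp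

section \<open>The additive character of the reals modulo 1 and its geometric sums\<close>

definition e :: "real \<Rightarrow> complex" where
  "e x = cis (2 * pi * x)"

lemma norm_e [simp]: "norm (e x) = 1"
  by (simp add: e_def)

lemma e_add: "e (x + y) = e x * e y"
  by (simp add: e_def cis_mult algebra_simps)

lemma e_of_int [simp]: "e (of_int m) = 1"
  by (simp add: e_def)

lemma cnj_e: "cnj (e x) = e (- x)"
  by (simp add: e_def cis_cnj)

lemma e_power: "e (real k * x) = e x ^ k"
  by (simp add: e_def DeMoivre mult_ac)

text \<open>A crude form of Jordan's inequality: the cubic Taylor bound \<open>x - x ^ 3 / 6\<close>
  is at least \<open>x / 3\<close> as long as \<open>x * x\<close> is at most 4.\<close>

lemma sin_ge_third: "0 \<le> x \<Longrightarrow> x \<le> 2 \<Longrightarrow> x / 3 \<le> sin x" for x :: real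
proof -
  assume x: "0 \<le> x" "x \<le> 2"
  have "\<bar>sin x - (\<Sum>m<3. sin_coeff m * x ^ m)\<bar> \<le> inverse (fact 3) * \<bar>x\<bar> ^ 3"
    by (rule Maclaurin_sin_bound)
  moreover have "(\<Sum>m<3. sin_coeff m * x ^ m) = x"
    by (simp add: eval_nat_numeral sin_coeff_def)
  ultimately have "\<bar>sin x - x\<bar> \<le> x ^ 3 / 6" using x by (simp add: fact_numeral)
  hence 1: "x - x^3/6 \<le> sin x" by linarith
  have "x * x \<le> 2 * 2" using x by (intro mult_mono) auto
  hence "x * (x * x) \<le> x * 4" using x by (intro mult_left_mono) auto
  thus ?thesis using 1 by (simp add: power3_eq_cube)
qed

text \<open>Both sides have period 1, so x may be replaced by its representative y in [-1/2, 1/2].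
  There the left side is the absolute value of y and the right side is a chord of the unit circle,
  of length \<open>2 * \<bar>sin (pi * y)\<bar>\<close>.\<close>

lemma norm_e_minus_1: "dist_int x \<le> norm (e x - 1)"
proof -
  define y where "y = x - of_int (round x)"
  have "e x = e (y + of_int (round x))" by (simp add: y_def)
  hence ey: "e x = e y" by (simp only: e_add e_of_int mult_1_right)
  have dy: "dist_int x = \<bar>y\<bar>" by (simp add: y_def dist_int_def)
  have y2: "\<bar>y\<bar> \<le> 1/2" using dist_int_le_half[of x] dy by simp
  have "(norm (e y - 1))\<^sup>2 = (cos (2*pi*y) - 1)\<^sup>2 + (sin (2*pi*y))\<^sup>2"
    by (simp add: e_def cmod_power2)
  also have "\<dots> = 2 - 2 * cos (2*pi*y)"
    using sin_cos_squared_add2[of "2*pi*y"] by (simp add: power2_eq_square algebra_simps)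
  also have "cos (2*pi*y) = 1 - 2 * (sin (pi*y))\<^sup>2"
    using cos_double_sin[of "pi*y"] by (simp add: mult.assoc)
  finally have "(norm (e y - 1))\<^sup>2 = (2 * sin (pi * y))\<^sup>2" by (simp add: power2_eq_square)
  hence n: "norm (e y - 1) = 2 * \<bar>sin (pi * y)\<bar>"
    by (metis abs_mult abs_numeral norm_ge_zero power2_eq_iff_nonneg power2_abs abs_ge_zero)
  have "\<bar>sin (pi * y)\<bar> = \<bar>sin (pi * \<bar>y\<bar>)\<bar>" by (cases "y \<ge> 0") auto
  moreover have "pi * \<bar>y\<bar> / 3 \<le> sin (pi * \<bar>y\<bar>)"
  proof (rule sin_ge_third)
    have "pi * \<bar>y\<bar> \<le> 4 * (1/2)" using y2 pi_less_4 by (intro mult_mono) auto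
    thus "pi * \<bar>y\<bar> \<le> 2" by simp
  qed auto
  moreover have "2 * \<bar>y\<bar> \<le> pi * \<bar>y\<bar>" using pi_ge_two by (intro mult_right_mono) auto
  ultimately have "2 * \<bar>y\<bar> / 3 \<le> \<bar>sin (pi * y)\<bar>" by linarith
  thus ?thesis using ey dy n by simp
qed

lemma geometric_e_bound:
  assumes "0 < dist_int x"
  shows "norm (\<Sum>k<K. e (real k * x)) \<le> 2 / dist_int x"
proof -
  have pos: "0 < norm (e x - 1)" using norm_e_minus_1[of x] assms by linarith
  hence ne: "e x \<noteq> 1" by auto
  have "(\<Sum>k<K. e (real k * x)) = (\<Sum>k<K. e x ^ k)" by (simp add: e_power)
  also have "\<dots> = (e x ^ K - 1) / (e x - 1)" by (rule geometric_sum[OF ne])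
  finally have "norm (\<Sum>k<K. e (real k * x)) = norm (e x ^ K - 1) / norm (e x - 1)"
    by (simp add: norm_divide)
  also have "\<dots> \<le> 2 / norm (e x - 1)"
    using pos norm_triangle_ineq4[of "e x ^ K" 1] by (intro divide_right_mono) (auto simp: norm_power)
  also have "\<dots> \<le> 2 / dist_int x"
    using assms pos norm_e_minus_1[of x] by (intro divide_left_mono) auto
  finally show ?thesis .
qed

section \<open>Recurrence of linear phases\<close>

lemma card_le_image_times_fibre:
  assumes "finite A" "\<And>y. y \<in> f ` A \<Longrightarrow> real (card {x\<in>A. f x = y}) \<le> B"
  shows "real (card A) \<le> real (card (f ` A)) * B"
proof -
  have "card A = (\<Sum>y\<in>f ` A. card {x. x \<in> A \<and> f x = y})"
    using sum.image_gen[OF assms(1), of "\<lambda>_. 1::nat" f] by simp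
  hence "real (card A) = (\<Sum>y\<in>f ` A. real (card {x. x \<in> A \<and> f x = y}))" by simp
  also have "\<dots> \<le> (\<Sum>y\<in>f ` A. B)" using assms(2) by (intro sum_mono) auto
  finally show ?thesis by simp
qed

text \<open>Cut the interval into windows of length w, the ceiling of 2 Z. There are fewer windows
  than members of E, so two members share one and differ by at most w - 1 < 2 Z.\<close>

lemma close_pair:
  fixes Z :: real
  assumes E: "E \<subseteq> {..<N}" and Z: "1 \<le> Z" and N: "2 * Z < real N"
    and card: "real N \<le> Z * real (card E)"
  obtains h h' where "h \<in> E" "h' \<in> E" "h < h'" "real (h' - h) \<le> 2 * Z"
proof -
  define w where "w = nat \<lceil>2 * Z\<rceil>"
  have w: "2 * Z \<le> real w" "real w < 2 * Z + 1" "0 < w" using Z unfolding w_def by linarith+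
  have fin: "finite E" using E finite_subset by blast
  have "(\<lambda>h. h div w) ` E \<subseteq> {..N div w}" using E by (auto intro!: div_le_mono)
  hence "card ((\<lambda>h. h div w) ` E) \<le> card {..N div w}" by (intro card_mono) auto
  hence "real (card ((\<lambda>h. h div w) ` E)) \<le> real (N div w) + 1" by simp
  also have "real (N div w) \<le> real N / real w" by (rule of_nat_div_le_of_nat)
  also have "real N / real w \<le> real N / (2 * Z)" using w Z by (intro divide_left_mono) auto
  also have "real N / (2 * Z) + 1 < real N / Z" using Z N by (simp add: field_simps)
  also have "real N / Z \<le> card E" using card Z by (simp add: field_simps)
  finally have "\<not> inj_on (\<lambda>h. h div w) E" by (intro pigeonhole) simp
  then obtain h h' where h: "h \<in> E" "h' \<in> E" "h \<noteq> h'" "h div w = h' div w"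
    by (auto simp: inj_on_def)
  have *: "h' - h < w" if "h div w = h' div w" for h h' :: nat
  proof -
    have "h' < w * (h' div w) + w" using w(3)
      by (metis add.commute mult.commute mod_less_divisor mod_mult_div_eq nat_add_left_cancel_less add_less_cancel_right)
    moreover have "w * (h div w) \<le> h" by simp
    ultimately show ?thesis using that w(3) by simp
  qed
  have **: "real (h' - h) \<le> 2 * Z" if "h div w = h' div w" for h h' :: nat
    using *[OF that] w by linarith
  show ?thesis
    using h **[of h h'] **[of h' h] that[of h h'] that[of h' h] by (cases "h < h'") auto
qed

lemma card_nat_diff_le:
  fixes I :: "nat set"
  assumes "finite I" "0 \<le> B" "\<And>i j. i \<in> I \<Longrightarrow> j \<in> I \<Longrightarrow> i < j \<Longrightarrow> real (j - i) \<le> B"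
  shows "real (card I) \<le> B + 1"
proof (cases "I = {}")
  case False
  define m where "m = Min I"
  have m: "m \<in> I" "\<And>i. i \<in> I \<Longrightarrow> m \<le> i" using False assms(1) by (auto simp: m_def)
  have "I \<subseteq> {m..m + nat \<lfloor>B\<rfloor>}"
  proof
    fix i assume i: "i \<in> I"
    show "i \<in> {m..m + nat \<lfloor>B\<rfloor>}"
    proof (cases "m < i")
      case True
      have "real (i - m) \<le> B" using assms(3)[OF m(1) i True] .
      hence "i - m \<le> nat \<lfloor>B\<rfloor>" using le_nat_floor by blast
      thus ?thesis using True by auto
    qed (use m(2)[OF i] in auto)
  qed
  hence "card I \<le> card {m..m + nat \<lfloor>B\<rfloor>}" by (intro card_mono) auto
  hence "real (card I) \<le> real (nat \<lfloor>B\<rfloor>) + 1" by simp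
  thus ?thesis using assms(2) by linarith
qed (use assms in simp)

text \<open>The gain over the pigeonhole principle is the factor \<open>N\<close> in the denominator: within a
  residue class and a window on which \<open>h \<theta>\<close> does not wrap around, the good \<open>h\<close> are confined to a
  run of length \<open>O(\<epsilon> / \<theta>)\<close>.\<close>
lemma strong_recurrence:
  fixes Z \<epsilon> :: real
  assumes E: "E \<subseteq> {..<N}" and Z: "1 \<le> Z" and N: "8 * Z\<^sup>2 \<le> real N"
    and card: "real N \<le> Z * real (card E)" and eps: "0 \<le> \<epsilon>" "64 * Z * \<epsilon> \<le> 1"
    and small: "\<And>h. h \<in> E \<Longrightarrow> dist_int (real h * \<beta>) \<le> \<epsilon>"
  shows "\<exists>q\<ge>1. real q \<le> 2 * Z \<and> dist_int (real q * \<beta>) * real N \<le> 8 * Z\<^sup>2 * \<epsilon>"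
proof -
  have fin: "finite E" using E finite_subset by blast
  have ZZ: "Z \<le> Z\<^sup>2" using Z by (simp add: power2_eq_square)
  have N2: "2 * Z < real N" using N ZZ Z by linarith
  obtain h0 h1 where h01: "h0 \<in> E" "h1 \<in> E" "h0 < h1" "real (h1 - h0) \<le> 2 * Z"
    by (rule close_pair[OF E Z N2 card])
  \<comment> \<open>This q inherits the approximation from h0 and h1 only up to 2 \<epsilon>,
    without any gain of a factor N. The rest of the proof shows that the same q already satisfies
    the stronger bound.\<close>
  define q where "q = h1 - h0"
  have q: "1 \<le> q" "real q \<le> 2 * Z" using h01 by (auto simp: q_def)
  define m where "m = round (real q * \<beta>)"
  define \<theta> where "\<theta> = real q * \<beta> - of_int m"
  have dq: "dist_int (real q * \<beta>) = \<bar>\<theta>\<bar>" by (simp add: \<theta>_def m_def dist_int_def)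
  have "real q * \<beta> = real h1 * \<beta> - real h0 * \<beta>" using h01 by (simp add: q_def of_nat_diff algebra_simps)
  hence t2: "\<bar>\<theta>\<bar> \<le> 2 * \<epsilon>"
    using dist_int_diff[of "real h1 * \<beta>" "real h0 * \<beta>"] small[OF h01(1)] small[OF h01(2)] dq by simp
  show ?thesis
  proof (cases "\<theta> = 0")
    case True
    thus ?thesis using q dq eps by (intro exI[of _ q]) auto
  next
    case False
    have "\<epsilon> \<le> Z * \<epsilon>" using Z eps by (simp add: mult_le_cancel_right1)
    hence e64: "\<epsilon> \<le> 1/64" using eps by linarith
    have tpos: "0 < \<bar>\<theta>\<bar>" using False by simp
    \<comment> \<open>As many steps of size \<theta> as fit into 1/2: inside such a window the
      distance of a multiple of \<theta> to the integers is simply its absolute value.\<close>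
    define w where "w = nat \<lfloor>1 / (2 * \<bar>\<theta>\<bar>)\<rfloor>"
    have big: "1 \<le> 1 / (2 * \<bar>\<theta>\<bar>)" using t2 e64 tpos by (simp add: field_simps)
    have w1: "real w \<le> 1 / (2 * \<bar>\<theta>\<bar>)" "1 / (2 * \<bar>\<theta>\<bar>) < real w + 1" "1 \<le> w"
      using big unfolding w_def by linarith+
    have w2: "1 / (4 * \<bar>\<theta>\<bar>) \<le> real w"
    proof -
      have "1 / (2 * \<bar>\<theta>\<bar>) \<le> 2 * real w" using w1 by linarith
      thus ?thesis by (simp add: field_simps)
    qed
    define B where "B = 2 * \<epsilon> / \<bar>\<theta>\<bar>"
    have B: "0 \<le> B" using eps by (simp add: B_def)
    define f where "f = (\<lambda>h. (h mod q, (h div q) div w))"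
    have fib: "real (card {h\<in>E. f h = y}) \<le> B + 1" for y
    proof -
      define I where "I = (\<lambda>h. h div q) ` {h\<in>E. f h = y}"
      have "inj_on (\<lambda>h. h div q) {h\<in>E. f h = y}"
        unfolding inj_on_def f_def by (metis (mono_tags, lifting) Pair_inject div_mult_mod_eq mem_Collect_eq)
      hence "card {h\<in>E. f h = y} = card I" unfolding I_def by (simp add: card_image)
      moreover have "real (card I) \<le> B + 1"
      proof (rule card_nat_diff_le)
        show "finite I" using fin by (simp add: I_def)
        fix i j assume ij: "i \<in> I" "j \<in> I" "i < j"
        obtain h where h: "h \<in> E" "f h = y" "i = h div q" using ij by (auto simp: I_def)
        obtain h' where h': "h' \<in> E" "f h' = y" "j = h' div q" using ij by (auto simp: I_def)
        have "h = q * i + h mod q" "h' = q * j + h' mod q" using h h' by auto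
        moreover have "h mod q = h' mod q" using h h' by (auto simp: f_def)
        ultimately have "real h' - real h = real q * (real j - real i)"
          by (metis add_diff_cancel_right of_nat_add of_nat_mult right_diff_distrib)
        hence hh: "real h' * \<beta> - real h * \<beta> = real (j - i) * \<theta> + of_int (int (j - i) * m)"
          using ij by (simp add: \<theta>_def of_nat_diff algebra_simps) (metis distrib_left mult.commute left_diff_distrib)
        have "i div w = j div w" using h h' by (auto simp: f_def)
        have "j < w * (j div w) + w" using w1(3)
          by (metis add.commute mult.commute mod_less_divisor mod_mult_div_eq add_less_cancel_right less_le_trans zero_less_one)
        moreover have "w * (i div w) \<le> i" by simp
        ultimately have "j - i < w" using \<open>i div w = j div w\<close> w1(3) by simp
        hence "real (j - i) * \<bar>\<theta>\<bar> \<le> real w * \<bar>\<theta>\<bar>" by (intro mult_right_mono) auto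
        also have "\<dots> \<le> 1/2" using w1(1) tpos by (simp add: field_simps)
        finally have s: "\<bar>real (j - i) * \<theta>\<bar> \<le> 1/2" by (simp add: abs_mult)
        have "real (j - i) * \<bar>\<theta>\<bar> = dist_int (real h' * \<beta> - real h * \<beta>)"
          unfolding hh dist_int_add_int dist_int_small[OF s] by (simp add: abs_mult)
        also have "\<dots> \<le> 2 * \<epsilon>" using dist_int_diff[of "real h' * \<beta>" "real h * \<beta>"] small[OF h(1)] small[OF h'(1)] by simp
        finally show "real (j - i) \<le> B" using tpos by (simp add: B_def field_simps)
      qed (rule B)
      ultimately show ?thesis by simp
    qed
    have "f ` E \<subseteq> {..<q} \<times> {..N div q div w}"
      using E q by (auto simp: f_def intro!: div_le_mono)
    hence "card (f ` E) \<le> card ({..<q} \<times> {..N div q div w})" by (intro card_mono) auto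
    hence "card (f ` E) \<le> q * (N div q div w + 1)" by (simp add: card_cartesian_product)
    hence "real (card (f ` E)) \<le> real (q * (N div q div w + 1))" by (rule of_nat_mono)
    also have "\<dots> = real q * (real (N div q div w) + 1)" by (simp add: algebra_simps)
    finally have "real (card (f ` E)) \<le> real q * (real (N div q div w) + 1)" .
    also have "\<dots> \<le> real q * (real N / (real q * real w) + 1)"
      using of_nat_div_le_of_nat[of N "q * w"] by (intro mult_left_mono) (auto simp: div_mult2_eq)
    also have "\<dots> = real N / real w + real q" using q by (simp add: field_simps)
    also have "real N / real w \<le> real N / (1 / (4 * \<bar>\<theta>\<bar>))"
      using w2 w1 tpos by (intro divide_left_mono) auto
    finally have im: "real (card (f ` E)) \<le> 4 * real N * \<bar>\<theta>\<bar> + real q" by simp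
    have "real (card E) \<le> real (card (f ` E)) * (B + 1)"
      by (rule card_le_image_times_fibre[OF fin fib])
    also have "\<dots> \<le> (4 * real N * \<bar>\<theta>\<bar> + real q) * (B + 1)"
      using im B by (intro mult_right_mono) auto
    also have "\<dots> = 8 * real N * \<epsilon> + 4 * real N * \<bar>\<theta>\<bar> + 2 * real q * \<epsilon> / \<bar>\<theta>\<bar> + real q"
      using tpos by (simp add: B_def field_simps)
    also have "\<dots> \<le> 16 * real N * \<epsilon> + 2 * real q * \<epsilon> / \<bar>\<theta>\<bar> + 2 * Z"
      using mult_left_mono[OF t2, of "real N"] q by (simp add: mult_ac)
    finally have "real (card E) \<le> 16 * real N * \<epsilon> + 2 * real q * \<epsilon> / \<bar>\<theta>\<bar> + 2 * Z" .
    hence "Z * real (card E) \<le> Z * (16 * real N * \<epsilon> + 2 * real q * \<epsilon> / \<bar>\<theta>\<bar> + 2 * Z)"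
      using Z by (intro mult_left_mono) auto
    also have "\<dots> = 16 * (real N * (Z * \<epsilon>)) + 2 * Z * real q * \<epsilon> / \<bar>\<theta>\<bar> + 2 * Z\<^sup>2"
      by (simp add: algebra_simps power2_eq_square)
    also have "real N * (Z * \<epsilon>) \<le> real N * (1/64)" using eps by (intro mult_left_mono) auto
    also have "2 * Z\<^sup>2 \<le> real N / 4" using N by simp
    \<comment> \<open>The hypotheses on \<epsilon> and N bound two of the three terms by N / 4 each.
      The term with \<theta> in the denominator must make up the remaining N / 2, and this bounds
      \<theta> from above.\<close>
    finally have "real N / 2 \<le> 2 * Z * real q * \<epsilon> / \<bar>\<theta>\<bar>" using card by linarith
    hence "\<bar>\<theta>\<bar> * real N \<le> 4 * Z * \<epsilon> * real q" using tpos by (simp add: field_simps)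
    also have "\<dots> \<le> 4 * Z * \<epsilon> * (2 * Z)" using q Z eps by (intro mult_left_mono) auto
    finally have "\<bar>\<theta>\<bar> * real N \<le> 8 * Z\<^sup>2 * \<epsilon>" by (simp add: power2_eq_square algebra_simps)
    thus ?thesis using q dq by (intro exI[of _ q]) auto
  qed
qed

section \<open>Weyl's inequality and Heilbronn's theorem\<close>

text \<open>Expand the square into a sum over pairs and group the pairs by their difference h. The
  induction on N adds the pairs whose larger member is N, one for each h.\<close>

lemma van_der_Corput_identity:
  fixes x :: "nat \<Rightarrow> real"
  shows "(norm (\<Sum>n<N. e (x n)))\<^sup>2 =
    real N + 2 * Re (\<Sum>h\<in>{1..<N}. \<Sum>n<N-h. e (x (n + h) - x n))"
proof (induction N)
  case (Suc N)
  define S where "S = (\<Sum>n<N. e (x n))"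
  have "(\<Sum>h\<in>{1..<Suc N}. \<Sum>n<Suc N-h. e (x (n + h) - x n)) =
    (\<Sum>h\<in>{1..<Suc N}. (\<Sum>n<N-h. e (x (n + h) - x n)) + e (x N - x (N - h)))"
    by (intro sum.cong) (auto simp: Suc_diff_le)
  also have "\<dots> = (\<Sum>h\<in>{1..<Suc N}. \<Sum>n<N-h. e (x (n + h) - x n)) +
      (\<Sum>h\<in>{1..<Suc N}. e (x N - x (N - h)))"
    by (rule sum.distrib)
  also have "(\<Sum>h\<in>{1..<Suc N}. \<Sum>n<N-h. e (x (n + h) - x n)) =
      (\<Sum>h\<in>{1..<N}. \<Sum>n<N-h. e (x (n + h) - x n))"
    by (cases "N = 0") (auto simp: atLeastLessThanSuc)
  also have "(\<Sum>h\<in>{1..<Suc N}. e (x N - x (N - h))) = (\<Sum>m<N. e (x N - x m))"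
    by (rule sum.reindex_bij_witness[of _ "\<lambda>m. N - m" "\<lambda>h. N - h"]) auto
  also have "\<dots> = e (x N) * cnj S"
    by (simp add: S_def sum_distrib_left cnj_e flip: e_add)
  finally have T: "(\<Sum>h\<in>{1..<Suc N}. \<Sum>n<Suc N-h. e (x (n + h) - x n)) =
    (\<Sum>h\<in>{1..<N}. \<Sum>n<N-h. e (x (n + h) - x n)) + e (x N) * cnj S" .
  have "(norm (S + e (x N)))\<^sup>2 = (norm S)\<^sup>2 + (norm (e (x N)))\<^sup>2 + 2 * Re (e (x N) * cnj S)"
    by (simp only: cmod_power2) (simp add: power2_eq_square algebra_simps)
  thus ?case using Suc.IH unfolding T by (simp add: S_def)
qed simp

lemma van_der_Corput_ineq:
  fixes x :: "nat \<Rightarrow> real"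
  shows "(norm (\<Sum>n<N. e (x n)))\<^sup>2 \<le>
    real N + 2 * (\<Sum>h\<in>{1..<N}. norm (\<Sum>n<N-h. e (x (n + h) - x n)))"
proof -
  have "Re (\<Sum>h\<in>{1..<N}. \<Sum>n<N-h. e (x (n + h) - x n)) \<le>
      norm (\<Sum>h\<in>{1..<N}. \<Sum>n<N-h. e (x (n + h) - x n))"
    by (rule complex_Re_le_cmod)
  also have "\<dots> \<le> (\<Sum>h\<in>{1..<N}. norm (\<Sum>n<N-h. e (x (n + h) - x n)))"
    by (rule norm_sum)
  finally show ?thesis using van_der_Corput_identity[of x N] by linarith
qed

text \<open>\<open>poly_seq d \<alpha> x\<close>: the sequence \<open>x\<close> is polynomial of degree at most \<open>d\<close> with \<open>d\<close>-th
  difference \<open>\<alpha>\<close>, i.e. leading coefficient \<open>\<alpha> / d!\<close>.\<close>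
fun poly_seq :: "nat \<Rightarrow> real \<Rightarrow> (nat \<Rightarrow> real) \<Rightarrow> bool" where
  "poly_seq 0 \<alpha> x \<longleftrightarrow> (\<forall>n. x n = \<alpha>)"
| "poly_seq (Suc d) \<alpha> x \<longleftrightarrow> (\<forall>h. poly_seq d (real h * \<alpha>) (\<lambda>n. x (n + h) - x n))"

lemma poly_seq_add:
  "poly_seq d \<alpha> x \<Longrightarrow> poly_seq d \<beta> y \<Longrightarrow> poly_seq d (\<alpha> + \<beta>) (\<lambda>n. x n + y n)"
proof (induction d arbitrary: \<alpha> \<beta> x y)
  case (Suc d)
  show ?case
  proof (simp, intro allI)
    fix h
    have "poly_seq d (real h * \<alpha> + real h * \<beta>) (\<lambda>n. (x (n + h) - x n) + (y (n + h) - y n))"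
      using Suc.prems by (intro Suc.IH) auto
    thus "poly_seq d (real h * (\<alpha> + \<beta>)) (\<lambda>n. x (n + h) + y (n + h) - (x n + y n))"
      by (simp add: algebra_simps)
  qed
qed auto

lemma poly_seq_scale: "poly_seq d \<alpha> x \<Longrightarrow> poly_seq d (c * \<alpha>) (\<lambda>n. c * x n)"
proof (induction d arbitrary: \<alpha> x)
  case (Suc d)
  show ?case
  proof (simp, intro allI)
    fix h
    have "poly_seq d (c * (real h * \<alpha>)) (\<lambda>n. c * (x (n + h) - x n))"
      using Suc.prems by (intro Suc.IH) auto
    thus "poly_seq d (real h * (c * \<alpha>)) (\<lambda>n. c * x (n + h) - c * x n)"
      by (simp add: algebra_simps)
  qed
qed auto

lemma poly_seq_zero: "poly_seq d 0 (\<lambda>n. 0)"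
  by (induction d) auto

lemma poly_seq_sum:
  "finite A \<Longrightarrow> (\<And>j. j \<in> A \<Longrightarrow> poly_seq d (\<alpha> j) (x j)) \<Longrightarrow>
    poly_seq d (\<Sum>j\<in>A. \<alpha> j) (\<lambda>n. \<Sum>j\<in>A. x j n)"
  by (induction A rule: finite_induct) (auto simp: poly_seq_zero intro: poly_seq_add)

lemma poly_seq_shift: "poly_seq d \<alpha> x \<Longrightarrow> poly_seq d \<alpha> (\<lambda>n. x (n + m))"
proof (induction d arbitrary: \<alpha> x)
  case (Suc d)
  show ?case
  proof (simp, intro allI)
    fix h
    have "poly_seq d (real h * \<alpha>) (\<lambda>n. x (n + m + h) - x (n + m))"
      using Suc.prems by (intro Suc.IH) auto
    thus "poly_seq d (real h * \<alpha>) (\<lambda>n. x (n + h + m) - x (n + m))"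
      by (simp add: add.assoc add.commute[of h m])
  qed
qed auto

lemma power_add_diff: "real (n + h) ^ k - real n ^ k =
    (\<Sum>j<k. (real (k choose j) * real h ^ (k - j)) * real n ^ j)"
proof -
  have "(real n + real h) ^ k = (\<Sum>j\<le>k. of_nat (k choose j) * real n ^ j * real h ^ (k - j))"
    by (rule binomial_ring)
  also have "{..k} = insert k {..<k}" by auto
  finally show ?thesis by (simp add: mult_ac)
qed

text \<open>The h-difference of n^k is a combination of lower powers by the binomial theorem. Only
  the power j = d contributes to the top difference, and only for k = d + 1, where it gives (d + 1)
  h d!.\<close>

lemma poly_seq_power:
  "k \<le> d \<Longrightarrow> poly_seq d (if k = d then fact d else 0) (\<lambda>n. real n ^ k)"
proof (induction d arbitrary: k)
  case (Suc d)
  show ?case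
  proof (simp only: poly_seq.simps, intro allI)
    fix h
    have "poly_seq d (\<Sum>j<k. (real (k choose j) * real h ^ (k - j)) * (if j = d then fact d else 0))
      (\<lambda>n. \<Sum>j<k. (real (k choose j) * real h ^ (k - j)) * real n ^ j)"
      using Suc.prems by (intro poly_seq_sum poly_seq_scale Suc.IH) auto
    moreover have "(\<Sum>j<k. (real (k choose j) * real h ^ (k - j)) * (if j = d then fact d else 0)) =
        real h * (if k = Suc d then fact (Suc d) else 0)"
      using Suc.prems by (cases "k = Suc d") (auto intro!: sum.neutral)
    ultimately show "poly_seq d (real h * (if k = Suc d then fact (Suc d) else 0))
      (\<lambda>n. real (n + h) ^ k - real n ^ k)"
      by (simp only: power_add_diff)
  qed
qed auto

section \<open>Weyl's inequality in inverse form, by induction on the degree\<close>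

lemma weyl_base:
  assumes "poly_seq (Suc 0) \<alpha> x" "1 \<le> X" "real N \<le> X * norm (\<Sum>n<N. e (x n))"
  shows "dist_int \<alpha> * real N \<le> 2 * X"
proof (cases "dist_int \<alpha> = 0")
  case False
  hence pos: "0 < dist_int \<alpha>" using dist_int_nonneg[of \<alpha>] by linarith
  have "x n = x 0 + real n * \<alpha>" for n
    using spec[OF assms(1)[unfolded poly_seq.simps], of n] by (auto dest: spec[of _ 0])
  hence "(\<Sum>n<N. e (x n)) = e (x 0) * (\<Sum>n<N. e (real n * \<alpha>))"
    unfolding sum_distrib_left by (intro sum.cong refl) (metis e_add)
  hence "norm (\<Sum>n<N. e (x n)) \<le> 2 / dist_int \<alpha>"
    using geometric_e_bound[OF pos] by (simp add: norm_mult)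
  hence "X * norm (\<Sum>n<N. e (x n)) \<le> X * (2 / dist_int \<alpha>)" using assms(2) by (intro mult_left_mono) auto
  with assms(3) have "real N \<le> X * (2 / dist_int \<alpha>)" by linarith
  thus ?thesis using pos by (simp add: field_simps)
qed (use assms in simp)

text \<open>A popularity argument: the terms outside the set contribute at most half of the lower
  bound that van der Corput's inequality gives for the sum over h, and each term inside is at most
  N. The condition on N makes the diagonal term harmless.\<close>

lemma many_large_differences:
  fixes x :: "nat \<Rightarrow> real"
  assumes X: "1 \<le> X" and N: "2 * X\<^sup>2 \<le> real N" and S: "real N \<le> X * norm (\<Sum>n<N. e (x n))"
  shows "real N \<le> 8 * X\<^sup>2 *
    real (card {h\<in>{1..<N}. real N \<le> 8 * X\<^sup>2 * norm (\<Sum>n<N-h. e (x (n + h) - x n))})"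
proof -
  define s where "s = (\<lambda>h. norm (\<Sum>n<N-h. e (x (n + h) - x n)))"
  define E where "E = {h\<in>{1..<N}. real N \<le> 8 * X\<^sup>2 * s h}"
  have X2: "1 \<le> X\<^sup>2" using X by simp
  have N0: "0 < real N" using N X2 by linarith
  have "(real N)\<^sup>2 \<le> (X * norm (\<Sum>n<N. e (x n)))\<^sup>2" using S by (intro power_mono) auto
  also have "\<dots> = X\<^sup>2 * (norm (\<Sum>n<N. e (x n)))\<^sup>2" by (simp add: power_mult_distrib)
  also have "\<dots> \<le> X\<^sup>2 * (real N + 2 * (\<Sum>h\<in>{1..<N}. s h))"
    unfolding s_def by (intro mult_left_mono van_der_Corput_ineq) auto
  also have "\<dots> = X\<^sup>2 * real N + 2 * X\<^sup>2 * (\<Sum>h\<in>{1..<N}. s h)" by (simp add: algebra_simps)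
  also have "X\<^sup>2 * real N \<le> (real N)\<^sup>2 / 2"
    using mult_right_mono[OF N, of "real N"] by (simp add: power2_eq_square)
  finally have 1: "(real N)\<^sup>2 \<le> 4 * X\<^sup>2 * (\<Sum>h\<in>{1..<N}. s h)" by linarith
  have s_le: "s h \<le> real N" for h
  proof -
    have "s h \<le> (\<Sum>n<N-h. norm (e (x (n + h) - x n)))" unfolding s_def by (rule norm_sum)
    thus ?thesis by simp
  qed
  have "(\<Sum>h\<in>{1..<N}. s h) \<le> (\<Sum>h\<in>{1..<N}. (if h \<in> E then real N else 0) + real N / (8 * X\<^sup>2))"
  proof (rule sum_mono)
    fix h assume h: "h \<in> {1..<N}"
    show "s h \<le> (if h \<in> E then real N else 0) + real N / (8 * X\<^sup>2)"
    proof (cases "h \<in> E")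
      case True
      thus ?thesis using s_le[of h] by (simp add: add_increasing2)
    next
      case False
      hence "s h * (8 * X\<^sup>2) \<le> real N" using h by (simp add: E_def mult_ac)
      hence "s h \<le> real N / (8 * X\<^sup>2)" using X2 by (subst pos_le_divide_eq) auto
      thus ?thesis using False by simp
    qed
  qed
  also have "\<dots> = real N * real (card E) + real (card {1..<N}) * (real N / (8 * X\<^sup>2))"
  proof -
    have "{1..<N} \<inter> {x. x \<in> E} = E" by (auto simp: E_def)
    thus ?thesis by (simp add: sum.distrib sum.If_cases)
  qed
  also have "real (card {1..<N}) * (real N / (8 * X\<^sup>2)) \<le> real N * (real N / (8 * X\<^sup>2))"
    by (intro mult_right_mono) auto
  finally have "4 * X\<^sup>2 * (\<Sum>h\<in>{1..<N}. s h) \<le>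
      4 * X\<^sup>2 * (real N * real (card E) + real N * (real N / (8 * X\<^sup>2)))"
    by (intro mult_left_mono) auto
  also have "\<dots> = 4 * X\<^sup>2 * real N * real (card E) + (real N)\<^sup>2 / 2"
    using X by (simp add: field_simps power2_eq_square)
  finally have "(real N)\<^sup>2 \<le> 8 * X\<^sup>2 * real N * real (card E)" using 1 by linarith
  hence "real N * real N \<le> real N * (8 * X\<^sup>2 * real (card E))"
    by (simp add: power2_eq_square algebra_simps)
  hence "real N \<le> 8 * X\<^sup>2 * real (card E)" using N0 by (simp only: mult_le_cancel_left_pos)
  thus ?thesis by (simp add: E_def s_def)
qed

lemma pigeonhole_fibre:
  fixes f :: "'a \<Rightarrow> nat"
  assumes E: "finite E" "E \<noteq> {}" and f: "\<And>h. h \<in> E \<Longrightarrow> 1 \<le> f h \<and> real (f h) \<le> B"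
  obtains q where "1 \<le> q" "real q \<le> B" "real (card E) \<le> B * real (card {h\<in>E. f h = q})"
proof -
  define M where "M = Max ((\<lambda>q. real (card {h\<in>E. f h = q})) ` f ` E)"
  have "M \<in> (\<lambda>q. real (card {h\<in>E. f h = q})) ` f ` E"
    unfolding M_def using E by (intro Max_in) auto
  then obtain h0 where h0: "h0 \<in> E" "M = real (card {h\<in>E. f h = f h0})" by auto
  have "real (card E) \<le> real (card (f ` E)) * M"
    using E by (intro card_le_image_times_fibre) (auto simp: M_def)
  also have "card (f ` E) \<le> card {1..nat \<lfloor>B\<rfloor>}"
    using f by (intro card_mono) (auto simp: le_nat_floor)
  hence "real (card (f ` E)) \<le> B" using f[OF h0(1)] by simp linarith
  hence "real (card (f ` E)) * M \<le> B * M" using h0 by (intro mult_right_mono) auto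
  finally show ?thesis using that[of "f h0"] f[OF h0(1)] h0 by auto
qed

text \<open>Differencing replaces \<alpha> by h \<alpha>, for a dense set of h. The hypothesis for
  degree D gives a denominator for each such h, the pigeonhole principle makes it the same q for
  many of them, and recurrence of the multiples h (q \<alpha>) then removes h. All losses are powers
  of C and of Y = 8 X^2, and W is chosen to dominate each of them.\<close>

lemma weyl_step:
  fixes C :: real
  assumes C: "1 \<le> C" and D: "1 \<le> D"
    and IH: "\<And>x \<alpha> N X. poly_seq D \<alpha> x \<Longrightarrow> 1 \<le> N \<Longrightarrow> 1 \<le> X \<Longrightarrow>
      real N \<le> X * norm (\<Sum>n<N. e (x n)) \<Longrightarrow>
      \<exists>q\<ge>1. real q \<le> C * X ^ K \<and> dist_int (real q * \<alpha>) * real N ^ D \<le> C * X ^ K"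
    and x: "poly_seq (Suc D) \<alpha> x" and N: "1 \<le> N" and X: "1 \<le> X"
    and S: "real N \<le> X * norm (\<Sum>n<N. e (x n))"
    and W_def: "W = 64 * C\<^sup>2 * (8 * X\<^sup>2) ^ (2 * K + D + 2)"
  shows "\<exists>q\<ge>1. real q \<le> W ^ (D + 2) \<and> dist_int (real q * \<alpha>) * real N ^ (Suc D) \<le> W ^ (D + 2)"
proof -
  define Y where "Y = 8 * X\<^sup>2"
  have X2: "1 \<le> X\<^sup>2" using X by simp
  have Y: "1 \<le> Y" using X2 unfolding Y_def by linarith
  have CC: "C \<le> C\<^sup>2" "1 \<le> C\<^sup>2" using C by (auto simp: power2_eq_square mult_le_cancel_right1 intro: mult_mono[of 1 C 1 C, simplified])
  have W: "W = 64 * C\<^sup>2 * Y ^ (2 * K + D + 2)" by (simp add: W_def Y_def)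
  have Ypow: "Y ^ a \<le> Y ^ b" if "a \<le> b" for a b using Y that by (rule power_increasing[rotated])
  have Y1: "1 \<le> Y ^ a" for a using Y by simp
  have YK: "Y ^ (2 * K) = Y ^ K * Y ^ K" "Y ^ (K * 2) = Y ^ K * Y ^ K"
    by (simp_all add: mult_2 mult_2_right power_add)
  have YW: "Y \<le> W"
  proof -
    have "1 * Y ^ 1 \<le> (64 * C\<^sup>2) * Y ^ (2 * K + D + 2)"
      using CC Ypow[of 1 "2 * K + D + 2"] Y by (intro mult_mono) auto
    thus ?thesis by (simp add: W)
  qed
  have W1: "1 \<le> W" using YW Y by linarith
  show ?thesis
  proof (cases "real N \<le> W")
    \<comment> \<open>For short sums q = 1 suffices, the power of N being itself below the permitted
      bound.\<close>
    case True
    have "dist_int (real 1 * \<alpha>) * real N ^ (Suc D) \<le> 1 * W ^ (Suc D)"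
      using dist_int_le_half[of \<alpha>] True by (intro mult_mono power_mono) auto
    also have "\<dots> \<le> W ^ (D + 2)" using W1 by simp
    finally show ?thesis using one_le_power[OF W1, of "D + 2"] by (intro exI[of _ 1]) auto
  next
    case False
    hence NW: "W \<le> real N" by simp
    define E where "E = {h\<in>{1..<N}. real N \<le> Y * norm (\<Sum>n<N-h. e (x (n + h) - x n))}"
    have finE: "finite E" by (simp add: E_def)
    have cE: "real N \<le> Y * real (card E)"
      unfolding E_def Y_def using NW YW X2 Y_def by (intro many_large_differences X S) linarith
    have "E \<noteq> {}" using cE N by auto
    define B where "B = C * Y ^ K"
    have B1: "1 \<le> B" using mult_mono[of 1 C 1 "Y ^ K"] C Y1[of K] by (simp add: B_def)
    define \<epsilon> where "\<epsilon> = B * Y ^ D / real N ^ D"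
    have ex: "\<exists>q. 1 \<le> q \<and> real q \<le> B \<and> dist_int (real h * (real q * \<alpha>)) \<le> \<epsilon>" if h: "h \<in> E" for h
    proof -
      have hN: "1 \<le> h" "h < N" "real N \<le> Y * norm (\<Sum>n<N-h. e (x (n + h) - x n))"
        using h by (auto simp: E_def)
      \<comment> \<open>The differenced sum has N - h terms. Being at least N / Y, it forces N - h
        to be at least N / Y as well, so N - h can be replaced by N at the cost of Y^D.\<close>
      have "norm (\<Sum>n<N-h. e (x (n + h) - x n)) \<le> (\<Sum>n<N-h. norm (e (x (n + h) - x n)))"
        by (rule norm_sum)
      hence "norm (\<Sum>n<N-h. e (x (n + h) - x n)) \<le> real (N - h)" by simp
      hence "Y * norm (\<Sum>n<N-h. e (x (n + h) - x n)) \<le> Y * real (N - h)"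
        using Y by (intro mult_left_mono) auto
      hence NY: "real N \<le> Y * real (N - h)" using hN by linarith
      have "\<exists>q\<ge>1. real q \<le> C * Y ^ K \<and> dist_int (real q * (real h * \<alpha>)) * real (N - h) ^ D \<le> C * Y ^ K"
        using x hN Y by (intro IH[of _ "\<lambda>n. x (n + h) - x n"]) auto
      then obtain q where q: "1 \<le> q" "real q \<le> B" "dist_int (real q * (real h * \<alpha>)) * real (N - h) ^ D \<le> B"
        by (auto simp: B_def)
      have "dist_int (real q * (real h * \<alpha>)) * real N ^ D \<le>
          dist_int (real q * (real h * \<alpha>)) * (Y * real (N - h)) ^ D"
        using NY by (intro mult_left_mono power_mono) auto
      also have "\<dots> = (dist_int (real q * (real h * \<alpha>)) * real (N - h) ^ D) * Y ^ D"
        by (simp add: power_mult_distrib)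
      also have "\<dots> \<le> B * Y ^ D" using q Y by (intro mult_right_mono) auto
      finally have "dist_int (real q * (real h * \<alpha>)) \<le> \<epsilon>"
        using N by (simp add: \<epsilon>_def field_simps)
      thus ?thesis using q by (intro exI[of _ q]) (auto simp: mult_ac)
    qed
    define f where "f = (\<lambda>h. SOME q. 1 \<le> q \<and> real q \<le> B \<and> dist_int (real h * (real q * \<alpha>)) \<le> \<epsilon>)"
    have f: "1 \<le> f h \<and> real (f h) \<le> B \<and> dist_int (real h * (real (f h) * \<alpha>)) \<le> \<epsilon>" if "h \<in> E" for h
      unfolding f_def by (rule someI_ex[OF ex[OF that]])
    obtain q where q: "1 \<le> q" "real q \<le> B" "real (card E) \<le> B * real (card {h\<in>E. f h = q})"
      using pigeonhole_fibre[OF finE \<open>E \<noteq> {}\<close>, of f B] f by blast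
    define F where "F = {h\<in>E. f h = q}"
    define Z where "Z = Y * B"
    have Z1: "1 \<le> Z" using mult_mono[of 1 Y 1 B] Y B1 by (simp add: Z_def)
    have NZ: "real N \<le> Z * real (card F)"
    proof -
      have "Y * real (card E) \<le> Y * (B * real (card F))"
        using q Y unfolding F_def by (intro mult_left_mono) auto
      thus ?thesis using cE by (simp add: Z_def mult.assoc)
    qed
    have N8: "8 * Z\<^sup>2 \<le> real N"
    proof -
      have "8 * Z\<^sup>2 = 8 * C\<^sup>2 * Y ^ (2 * K + 2)"
        by (simp add: Z_def B_def power_mult_distrib power2_eq_square power_add YK algebra_simps)
      also have "\<dots> \<le> 64 * C\<^sup>2 * Y ^ (2 * K + D + 2)"
        using C Y by (intro mult_mono Ypow) auto
      finally show ?thesis using NW W by linarith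
    qed
    have e0: "0 \<le> \<epsilon>" using B1 Y by (simp add: \<epsilon>_def)
    have e64: "64 * Z * \<epsilon> \<le> 1"
    proof -
      have "64 * Z * (B * Y ^ D) = 64 * C\<^sup>2 * Y ^ (2 * K + D + 1)"
        by (simp add: Z_def B_def power_mult_distrib power2_eq_square power_add YK algebra_simps)
      also have "\<dots> \<le> W" unfolding W using C by (intro mult_left_mono Ypow) auto
      also have "\<dots> \<le> real N ^ 1" using NW by simp
      also have "\<dots> \<le> real N ^ D" using N D by (intro power_increasing) auto
      finally show ?thesis using N by (simp add: \<epsilon>_def field_simps)
    qed
    \<comment> \<open>Here the degree goes up: \<epsilon> is of order N^(-D), and the factor N
      gained by the recurrence lemma turns it into order N^(-D-1).\<close>
    have "\<exists>q'\<ge>1. real q' \<le> 2 * Z \<and> dist_int (real q' * (real q * \<alpha>)) * real N \<le> 8 * Z\<^sup>2 * \<epsilon>"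
    proof (rule strong_recurrence[OF _ Z1 N8 NZ e0 e64])
      show "F \<subseteq> {..<N}" by (auto simp: F_def E_def)
      show "dist_int (real h * (real q * \<alpha>)) \<le> \<epsilon>" if "h \<in> F" for h using that f[of h] by (auto simp: F_def)
    qed
    then obtain q' where q': "1 \<le> q'" "real q' \<le> 2 * Z"
      "dist_int (real q' * (real q * \<alpha>)) * real N \<le> 8 * Z\<^sup>2 * \<epsilon>" by blast
    have "real (q' * q) \<le> W ^ 1"
    proof -
      have "real q' * real q \<le> (2 * Z) * B" using q q' B1 Z1 by (intro mult_mono) auto
      also have "\<dots> = 2 * C\<^sup>2 * Y ^ (2 * K + 1)"
        by (simp add: Z_def B_def power2_eq_square power_add YK algebra_simps)
      also have "\<dots> \<le> 64 * C\<^sup>2 * Y ^ (2 * K + D + 2)"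
        using C Y by (intro mult_mono Ypow) auto
      finally show ?thesis by (simp add: W)
    qed
    also have "\<dots> \<le> W ^ (D + 2)" using W1 by (intro power_increasing) auto
    finally have r1: "real (q' * q) \<le> W ^ (D + 2)" .
    have "dist_int (real (q' * q) * \<alpha>) * real N ^ Suc D = (dist_int (real q' * (real q * \<alpha>)) * real N) * real N ^ D"
      by (simp add: mult_ac)
    also have "\<dots> \<le> 8 * Z\<^sup>2 * \<epsilon> * real N ^ D" using q' by (intro mult_right_mono) auto
    also have "\<dots> = 8 * Z\<^sup>2 * (B * Y ^ D)" using N by (simp add: \<epsilon>_def)
    also have "\<dots> \<le> W * W"
    proof (rule mult_mono)
      show "8 * Z\<^sup>2 \<le> W"
      proof -
        have "8 * Z\<^sup>2 = 8 * C\<^sup>2 * Y ^ (2 * K + 2)"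
          by (simp add: Z_def B_def power_mult_distrib power2_eq_square power_add YK algebra_simps)
        also have "\<dots> \<le> 64 * C\<^sup>2 * Y ^ (2 * K + D + 2)"
          using C Y by (intro mult_mono Ypow) auto
        finally show ?thesis by (simp add: W)
      qed
      have "B * Y ^ D = C * Y ^ (K + D)" by (simp add: B_def power_add)
      also have "\<dots> \<le> (64 * C\<^sup>2) * Y ^ (2 * K + D + 2)"
        using C CC Y by (intro mult_mono Ypow) auto
      finally show "B * Y ^ D \<le> W" by (simp add: W)
    qed (use B1 Y W1 in auto)
    also have "W * W = W ^ 2" by (simp add: power2_eq_square)
    also have "\<dots> \<le> W ^ (D + 2)" using W1 by (intro power_increasing) auto
    finally show ?thesis using r1 q q' by (intro exI[of _ "q' * q"]) auto
  qed
qed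

text \<open>Stated as an inverse theorem: a sum within a factor X of the trivial bound N produces a
  rational approximation to \<alpha>, with losses polynomial in X only. As \<alpha> is the top
  difference, it is a factorial times the leading coefficient.\<close>

lemma weyl:
  "\<exists>C\<ge>1. \<exists>K. \<forall>x \<alpha> N X. poly_seq (Suc d) \<alpha> x \<longrightarrow> 1 \<le> N \<longrightarrow> 1 \<le> X \<longrightarrow>
      real N \<le> X * norm (\<Sum>n<N. e (x n)) \<longrightarrow>
      (\<exists>q\<ge>1. real q \<le> C * X ^ K \<and> dist_int (real q * \<alpha>) * real N ^ Suc d \<le> C * X ^ K)"
proof (induction d)
  case 0
  show ?case
  proof (rule exI[of _ 2], intro conjI exI[of _ 1] allI impI)
    fix x \<alpha> N and X :: real
    assume *: "poly_seq (Suc 0) \<alpha> x" "1 \<le> N" "1 \<le> X" "real N \<le> X * norm (\<Sum>n<N. e (x n))"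
    show "real 1 \<le> 2 * X ^ 1" "dist_int (real 1 * \<alpha>) * real N ^ Suc 0 \<le> 2 * X ^ 1"
      using weyl_base[OF *(1,3,4)] *(3) by auto
  qed simp_all
next
  case (Suc d)
  then obtain C K where C: "1 \<le> C" and
    IH: "\<And>x \<alpha> N X. poly_seq (Suc d) \<alpha> x \<Longrightarrow> 1 \<le> N \<Longrightarrow> 1 \<le> X \<Longrightarrow>
      real N \<le> X * norm (\<Sum>n<N. e (x n)) \<Longrightarrow>
      \<exists>q\<ge>1. real q \<le> C * X ^ K \<and> dist_int (real q * \<alpha>) * real N ^ Suc d \<le> C * X ^ K"
    by blast
  define m where "m = 2 * K + Suc d + 2"
  define C' where "C' = (64 * C\<^sup>2 * 8 ^ m) ^ (Suc d + 2)"
  have W: "(64 * C\<^sup>2 * (8 * X\<^sup>2) ^ m) ^ (Suc d + 2) = C' * X ^ (2 * m * (Suc d + 2))" for X :: real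
    by (simp only: C'_def power_mult_distrib power_mult mult.assoc)
  have "1 \<le> 64 * C\<^sup>2 * 8 ^ m" using mult_mono[of 1 "64 * C\<^sup>2" 1 "8 ^ m"] C one_le_power[OF C, of 2] by simp
  hence "1 \<le> C'" unfolding C'_def by (rule one_le_power)
  moreover have "\<exists>q\<ge>1. real q \<le> C' * X ^ (2 * m * (Suc d + 2)) \<and>
      dist_int (real q * \<alpha>) * real N ^ Suc (Suc d) \<le> C' * X ^ (2 * m * (Suc d + 2))"
    if "poly_seq (Suc (Suc d)) \<alpha> x" "1 \<le> N" "1 \<le> X" "real N \<le> X * norm (\<Sum>n<N. e (x n))" for x \<alpha> N X
  proof -
    have "1 \<le> Suc d" by simp
    from weyl_step[OF C this IH that refl] show ?thesis unfolding m_def[symmetric] W .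
  qed
  ultimately show ?case by blast
qed

text \<open>A Fejer kernel argument with K = 16 M^2. For each n the double sum over k and l is the
  squared modulus of a geometric sum, at most 4 M^2 = K / 4, while its diagonal alone contributes K.
  Summed over n, the off-diagonal part must compensate for 3/4 of K N, which is impossible if all
  its sums are below N / (2 K).\<close>

lemma large_exponential_sum:
  assumes N: "1 \<le> N" and M: "1 \<le> M" and far: "\<And>n. n < N \<Longrightarrow> 1 \<le> real M * dist_int (x n)"
  shows "\<exists>k l. k < 16 * M\<^sup>2 \<and> l < 16 * M\<^sup>2 \<and> k \<noteq> l \<and>
    real N \<le> 32 * (real M)\<^sup>2 * norm (\<Sum>n<N. e ((real k - real l) * x n))"
proof (rule ccontr)
  define K where "K = 16 * M\<^sup>2"
  define s where "s = (\<lambda>k l. \<Sum>n<N. e ((real k - real l) * x n))"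
  assume "\<not> ?thesis"
  hence small: "2 * real K * norm (s k l) < real N" if "k < K" "l < K" "k \<noteq> l" for k l
    using that unfolding K_def s_def by (auto simp: not_le)
  have K1: "1 \<le> K" using M by (simp add: K_def Suc_le_eq)
  have "(\<Sum>k<K. \<Sum>l<K. s k l) = (\<Sum>k<K. \<Sum>n<N. \<Sum>l<K. e ((real k - real l) * x n))"
    unfolding s_def by (intro sum.cong refl sum.swap)
  also have "\<dots> = (\<Sum>n<N. \<Sum>k<K. \<Sum>l<K. e ((real k - real l) * x n))" by (rule sum.swap)
  also have "\<dots> = (\<Sum>n<N. (\<Sum>k<K. e (real k * x n)) * cnj (\<Sum>l<K. e (real l * x n)))"
    by (intro sum.cong refl)
      (simp add: sum_product cnj_e left_diff_distrib flip: e_add)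
  finally have "norm (\<Sum>k<K. \<Sum>l<K. s k l) \<le>
      (\<Sum>n<N. norm ((\<Sum>k<K. e (real k * x n)) * cnj (\<Sum>l<K. e (real l * x n))))"
    by (simp only: norm_sum)
  also have "\<dots> \<le> (\<Sum>n<N. 4 * (real M)\<^sup>2)"
  proof (rule sum_mono)
    fix n assume n: "n \<in> {..<N}"
    have "0 < dist_int (x n)" using far[of n] n by (cases "dist_int (x n) = 0") (auto simp: less_le)
    hence "norm (\<Sum>k<K. e (real k * x n)) \<le> 2 / dist_int (x n)" by (rule geometric_e_bound)
    also have "\<dots> \<le> 2 * real M" using far[of n] n \<open>0 < dist_int (x n)\<close> by (simp add: field_simps)
    finally have "norm (\<Sum>k<K. e (real k * x n)) * norm (\<Sum>k<K. e (real k * x n)) \<le> (2 * real M) * (2 * real M)"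
      by (intro mult_mono) auto
    thus "norm ((\<Sum>k<K. e (real k * x n)) * cnj (\<Sum>l<K. e (real l * x n))) \<le> 4 * (real M)\<^sup>2"
      by (simp only: norm_mult complex_mod_cnj) (simp add: power2_eq_square)
  qed
  also have "\<dots> = real K * real N / 4" by (simp add: K_def)
  finally have A: "norm (\<Sum>k<K. \<Sum>l<K. s k l) \<le> real K * real N / 4" .
  have "(\<Sum>l<K. s k l) = of_nat N + (\<Sum>l\<in>{..<K}-{k}. s k l)" if "k < K" for k
    using that by (subst sum.remove[of _ k]) (auto simp: s_def e_def)
  hence "(\<Sum>k<K. \<Sum>l<K. s k l) = of_nat (K * N) + (\<Sum>k<K. \<Sum>l\<in>{..<K}-{k}. s k l)"
    by (simp add: sum.distrib)
  hence "of_nat (K * N) = (\<Sum>k<K. \<Sum>l<K. s k l) - (\<Sum>k<K. \<Sum>l\<in>{..<K}-{k}. s k l)" by simp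
  hence "norm (of_nat (K * N) :: complex) \<le>
      norm (\<Sum>k<K. \<Sum>l<K. s k l) + norm (\<Sum>k<K. \<Sum>l\<in>{..<K}-{k}. s k l)"
    by (simp only: norm_triangle_ineq4)
  also have "norm (of_nat (K * N) :: complex) = real (K * N)" by (rule norm_of_nat)
  also have "norm (\<Sum>k<K. \<Sum>l\<in>{..<K}-{k}. s k l) \<le> (\<Sum>k<K. \<Sum>l\<in>{..<K}-{k}. norm (s k l))"
    by (intro order_trans[OF norm_sum] sum_mono norm_sum)
  also have "\<dots> \<le> (\<Sum>k<K. \<Sum>l\<in>{..<K}-{k}. real N / (2 * real K))"
    using small K1 by (intro sum_mono) (auto simp: field_simps less_imp_le)
  also have "\<dots> \<le> (\<Sum>k<K. \<Sum>l<K. real N / (2 * real K))"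
    by (intro sum_mono sum_mono2) auto
  also have "\<dots> = real K * real N / 2" using K1 by simp
  finally have "real (K * N) \<le> real K * real N / 4 + real K * real N / 2" using A by linarith
  moreover have "0 < real K * real N" using K1 N by simp
  ultimately show False by simp
qed

text \<open>If every n up to N fails, some multiple of \<alpha> by k - l has a large exponential
  sum, and Weyl's inequality yields a bounded Q with Q \<alpha> extremely close to an integer. Then
  Q^(d+1) \<alpha> is close to an integer as well, merely because Q^d is bounded while N is
  large.\<close>

lemma heilbronn:
  "\<exists>C\<ge>1. \<exists>K. \<forall>\<alpha>. \<forall>M\<ge>1. \<exists>q\<ge>1. real q \<le> C * real M ^ K \<and> real M * dist_int (real q ^ Suc d * \<alpha>) \<le> 1"
proof -
  obtain C K where C: "1 \<le> C" and
    weyl: "\<And>x \<alpha> N X. poly_seq (Suc d) \<alpha> x \<Longrightarrow> 1 \<le> N \<Longrightarrow> 1 \<le> X \<Longrightarrow>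
      real N \<le> X * norm (\<Sum>n<N. e (x n)) \<Longrightarrow>
      \<exists>q\<ge>1. real q \<le> C * X ^ K \<and> dist_int (real q * \<alpha>) * real N ^ Suc d \<le> C * X ^ K"
    using weyl[of d] by blast
  define C' where "C' = 32 * fact (Suc d) * (C * 32 ^ K)\<^sup>2"
  define K' where "K' = 4 * K + 3"
  have main: "\<exists>q\<ge>1. real q \<le> C' * real M ^ K' \<and> real M * dist_int (real q ^ Suc d * \<alpha>) \<le> 1"
    if M: "1 \<le> M" for \<alpha> and M :: nat
  proof -
    define B where "B = C * (32 * (real M)\<^sup>2) ^ K"
    define U where "U = B * (16 * (real M)\<^sup>2) * fact (Suc d)"
    have M2: "1 \<le> (real M)\<^sup>2" using M by simp
    have M32: "1 \<le> 32 * (real M)\<^sup>2" "1 \<le> 16 * (real M)\<^sup>2" using M2 by linarith+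
    have B1: "1 \<le> B" unfolding B_def using mult_mono[OF C one_le_power[OF M32(1), of K]] C by simp
    have BU: "B \<le> U"
      unfolding U_def using B1 M32 mult_mono[of 1 "16 * (real M)\<^sup>2" 1 "fact (Suc d)"]
      by (simp add: mult.assoc mult_le_cancel_left1 del: fact_Suc)
    have U1: "1 \<le> U" using B1 BU by linarith
    \<comment> \<open>U bounds the Q found below. N is at least V = U B M, so that U^d B M is at
      most N^(d+1); the constants C' and K' are read off from 2 V.\<close>
    define V where "V = U * B * real M"
    have UB1: "1 \<le> U * B" using mult_mono[OF U1 B1] U1 by simp
    have V1: "U \<le> V" "1 \<le> V"
    proof -
      have "1 \<le> B * real M" using mult_mono[OF B1, of 1 "real M"] B1 M by simp
      thus "U \<le> V" using U1 by (simp add: V_def mult.assoc mult_le_cancel_left1)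
      thus "1 \<le> V" using U1 by linarith
    qed
    define N where "N = nat \<lceil>V\<rceil>"
    have N: "V \<le> real N" "real N \<le> 2 * V" "1 \<le> N" using V1 unfolding N_def by linarith+
    have V2: "2 * V = C' * real M ^ K'"
      by (simp add: V_def U_def B_def C'_def K'_def power_mult_distrib power_add power2_eq_square
            power3_eq_cube algebra_simps mult_2 flip: power_mult)
        (simp add: power_add numeral_eq_Suc)
    show ?thesis
    proof (cases "\<exists>n<N. real M * dist_int (real (n + 1) ^ Suc d * \<alpha>) \<le> 1")
      case True
      then obtain n where n: "n < N" "real M * dist_int (real (n + 1) ^ Suc d * \<alpha>) \<le> 1" by blast
      have "real (n + 1) \<le> real N" using n by simp
      thus ?thesis using n N V2 by (intro exI[of _ "n + 1"] conjI) (linarith | simp)+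
    next
      case False
      have "\<exists>k l. k < 16 * M\<^sup>2 \<and> l < 16 * M\<^sup>2 \<and> k \<noteq> l \<and>
        real N \<le> 32 * (real M)\<^sup>2 * norm (\<Sum>n<N. e ((real k - real l) * (real (n + 1) ^ Suc d * \<alpha>)))"
        using False by (intro large_exponential_sum N M) (auto simp: not_le less_imp_le)
      then obtain k l where kl: "k < 16 * M\<^sup>2" "l < 16 * M\<^sup>2" "k \<noteq> l"
        "real N \<le> 32 * (real M)\<^sup>2 * norm (\<Sum>n<N. e ((real k - real l) * (real (n + 1) ^ Suc d * \<alpha>)))"
        by blast
      define c where "c = (real k - real l) * \<alpha>"
      have ps0: "poly_seq (Suc d) (fact (Suc d)) (\<lambda>n. real n ^ Suc d)"
        using poly_seq_power[of "Suc d" "Suc d"] by simp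
      have ps: "poly_seq (Suc d) (c * fact (Suc d)) (\<lambda>n. c * real (n + 1) ^ Suc d)"
        by (intro poly_seq_scale poly_seq_shift[where x = "\<lambda>n. real n ^ Suc d"] ps0)
      have cx: "(\<lambda>n. (real k - real l) * (real (n + 1) ^ Suc d * \<alpha>)) = (\<lambda>n. c * real (n + 1) ^ Suc d)"
        by (auto simp: c_def)
      obtain q where q: "1 \<le> q" "real q \<le> B" "dist_int (real q * (c * fact (Suc d))) * real N ^ Suc d \<le> B"
        using weyl[OF ps N(3) M32(1) kl(4)[unfolded fun_cong[OF cx]]] unfolding B_def by blast
      define m where "m = nat \<bar>int k - int l\<bar>"
      have m: "1 \<le> m" "real m = \<bar>real k - real l\<bar>" "m < 16 * M\<^sup>2"
        using kl unfolding m_def by auto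
      \<comment> \<open>The factors k - l and (d + 1)! come from the multiple of \<alpha> in the sum
        and from the top difference of n^(d+1); they are moved from \<alpha> into the
        denominator.\<close>
      define Q where "Q = q * m * fact (Suc d)"
      have Q1: "1 \<le> Q" using q m fact_ge_1[of "Suc d", where 'a=nat] unfolding Q_def
        by (metis One_nat_def Suc_le_eq mult_pos_pos)
      have "real m \<le> 16 * (real M)\<^sup>2" using m(3)
        by (metis less_imp_le of_nat_le_iff of_nat_mult of_nat_numeral of_nat_power)
      hence QU: "real Q \<le> U" unfolding Q_def U_def using q B1 by (simp add: mult_mono del: fact_Suc)
      have dQ: "dist_int (real Q * \<alpha>) = dist_int (real q * (c * fact (Suc d)))"
      proof (cases "k \<ge> l")
        case True
        hence "real Q * \<alpha> = real q * (c * fact (Suc d))" using m by (simp add: Q_def c_def del: fact_Suc)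
        thus ?thesis by simp
      next
        case False
        hence "real Q * \<alpha> = - (real q * (c * fact (Suc d)))"
          using m(2) by (simp add: Q_def c_def del: fact_Suc) (simp add: left_diff_distrib right_diff_distrib del: fact_Suc)
        thus ?thesis by simp
      qed
      have "dist_int (real Q ^ Suc d * \<alpha>) = dist_int (real (Q ^ d) * (real Q * \<alpha>))" by (simp add: mult_ac)
      also have "\<dots> \<le> real (Q ^ d) * dist_int (real Q * \<alpha>)" by (rule dist_int_mult_nat)
      also have "\<dots> \<le> U ^ d * dist_int (real Q * \<alpha>)"
        using QU by (intro mult_right_mono) (auto intro: power_mono)
      finally have "real M * dist_int (real Q ^ Suc d * \<alpha>) * real N ^ Suc d \<le>
          real M * (U ^ d * dist_int (real Q * \<alpha>)) * real N ^ Suc d"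
        by (intro mult_right_mono mult_left_mono) auto
      also have "\<dots> = real M * U ^ d * (dist_int (real Q * \<alpha>) * real N ^ Suc d)" by (simp add: mult_ac)
      also have "\<dots> \<le> real M * U ^ d * B" using q U1 dQ by (intro mult_left_mono) auto
      also have "\<dots> = U ^ d * (B * real M)" by (simp add: mult_ac)
      also have "\<dots> \<le> V ^ d * V"
        using V1 U1 B1 UB1 by (intro mult_mono power_mono) (auto simp: V_def mult.assoc mult_le_cancel_right1)
      also have "\<dots> \<le> real N ^ Suc d" using power_mono[OF N(1), of "Suc d"] V1 by (simp add: mult_ac)
      finally have "real M * dist_int (real Q ^ Suc d * \<alpha>) \<le> 1"
        using N(3) by (simp add: mult_le_cancel_right1 del: power_Suc)
      moreover have "real Q \<le> C' * real M ^ K'" using QU V1 V2 by linarith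
      ultimately show ?thesis using Q1 by blast
    qed
  qed
  have "1 \<le> (C * 32 ^ K)\<^sup>2" using C mult_mono[OF C one_le_power[of "32::real" K]] by simp
  moreover have "(1::real) \<le> 32 * fact (Suc d)" using fact_ge_1[of "Suc d", where 'a=real] by linarith
  ultimately have "1 * 1 \<le> C'" unfolding C'_def by (intro mult_mono) auto
  hence "1 \<le> C'" by simp
  thus ?thesis using main by blast
qed

section \<open>Coverings by arithmetic progressions\<close>

text \<open>A triple \<open>(r, q, l)\<close> stands for the progression \<open>r, r + q, \<dots>, r + q (l - 1)\<close>. The bounds on the
  number and on the length of the progressions are tied together so that iterated refinements only
  multiply the \<open>\<eta>\<close>'s.\<close>
definition covered :: "real \<Rightarrow> real \<Rightarrow> nat \<Rightarrow> (nat \<Rightarrow> nat \<Rightarrow> nat \<Rightarrow> bool) \<Rightarrow> bool" where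
  "covered \<eta> C H P \<longleftrightarrow> (\<exists>S. finite S \<and> real (card S) \<le> C * real H powr (1 - \<eta>) \<and>
     (\<forall>(r, q, l)\<in>S. real l \<le> C * real H powr \<eta> \<and> (\<forall>i<l. r + q * i < H) \<and> P r q l) \<and>
     (\<forall>h<H. \<exists>(r, q, l)\<in>S. \<exists>i<l. h = r + q * i))"

lemma covered_mono:
  assumes P: "covered \<eta> C H P"
    and PQ: "\<And>r q l. P r q l \<Longrightarrow> (\<forall>i<l. r + q * i < H) \<Longrightarrow> Q r q l"
  shows "covered \<eta> C H Q"
proof -
  obtain S where S: "finite S" "real (card S) \<le> C * real H powr (1 - \<eta>)"
    "\<forall>(r, q, l)\<in>S. real l \<le> C * real H powr \<eta> \<and> (\<forall>i<l. r + q * i < H) \<and> P r q l"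
    "\<forall>h<H. \<exists>(r, q, l)\<in>S. \<exists>i<l. h = r + q * i"
    using P unfolding covered_def by auto
  have "\<forall>(r, q, l)\<in>S. real l \<le> C * real H powr \<eta> \<and> (\<forall>i<l. r + q * i < H) \<and> Q r q l"
    using S(3) PQ by blast
  thus ?thesis unfolding covered_def using S by blast
qed

lemma covered_mono_const:
  assumes P: "covered \<eta> C H P" and C: "C \<le> C'"
  shows "covered \<eta> C' H P"
proof -
  obtain S where S: "finite S" "real (card S) \<le> C * real H powr (1 - \<eta>)"
    "\<forall>(r, q, l)\<in>S. real l \<le> C * real H powr \<eta> \<and> (\<forall>i<l. r + q * i < H) \<and> P r q l"
    "\<forall>h<H. \<exists>(r, q, l)\<in>S. \<exists>i<l. h = r + q * i"
    using P unfolding covered_def by auto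
  have *: "C * real H powr x \<le> C' * real H powr x" for x using C by (intro mult_right_mono) auto
  have "\<forall>(r, q, l)\<in>S. real l \<le> C' * real H powr \<eta> \<and> (\<forall>i<l. r + q * i < H) \<and> P r q l"
    using S(3) *[of \<eta>] by (fastforce elim: order_trans)
  thus ?thesis unfolding covered_def using S order_trans[OF S(2) *] by blast
qed

lemma covered_trivial: "1 \<le> H \<Longrightarrow> P 0 1 H \<Longrightarrow> covered 1 1 H P"
  unfolding covered_def by (intro exI[of _ "{(0, 1, H)}"]) auto

text \<open>The exponents fit because H^(1-\<eta>) progressions, each cut into
  (H^\<eta>)^(1-\<eta>') pieces, make H^(1-\<eta>\<eta>') in all, and the lengths become
  (H^\<eta>)^\<eta>'. Only upper bounds on lengths enter, so short progressions do no harm.\<close>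

lemma covered_refine:
  assumes P: "covered \<eta> C H P" and C: "1 \<le> C" and C': "1 \<le> C'" and H: "1 \<le> H"
    and \<eta>': "0 \<le> \<eta>'" "\<eta>' \<le> 1"
    and Q: "\<And>r q l. P r q l \<Longrightarrow> 1 \<le> l \<Longrightarrow> (\<forall>i<l. r + q * i < H) \<Longrightarrow>
      covered \<eta>' C' l (\<lambda>r' q' l'. Q (r + q * r') (q * q') l')"
  shows "covered (\<eta> * \<eta>') (C\<^sup>2 * C') H Q"
proof -
  obtain S where S: "finite S" "real (card S) \<le> C * real H powr (1 - \<eta>)"
    "\<And>r q l. (r, q, l) \<in> S \<Longrightarrow> real l \<le> C * real H powr \<eta> \<and> (\<forall>i<l. r + q * i < H) \<and> P r q l"
    "\<And>h. h < H \<Longrightarrow> \<exists>(r, q, l)\<in>S. \<exists>i<l. h = r + q * i"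
    using P unfolding covered_def by fast
  \<comment> \<open>Empty progressions cover nothing and are dropped, since the refinement is
    available for positive length only.\<close>
  define S1 where "S1 = {(r, q, l) \<in> S. 1 \<le> l}"
  have S1: "finite S1" "S1 \<subseteq> S" using S(1) by (auto simp: S1_def intro: finite_subset[of _ S])
  define good where "good = (\<lambda>(r, q, l) T. finite T \<and> real (card T) \<le> C' * real l powr (1 - \<eta>') \<and>
     (\<forall>(r', q', l')\<in>T. real l' \<le> C' * real l powr \<eta>' \<and> (\<forall>i<l'. r' + q' * i < l) \<and>
        Q (r + q * r') (q * q') l') \<and> (\<forall>h<l. \<exists>(r', q', l')\<in>T. \<exists>i<l'. h = r' + q' * i))"
  have "\<exists>T. good s T" if s: "s \<in> S1" for s
  proof -
    obtain r q l where rql: "s = (r, q, l)" by (cases s) auto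
    hence "(r, q, l) \<in> S" "1 \<le> l" using s by (auto simp: S1_def)
    thus ?thesis using Q[of r q l] S(3)[of r q l] unfolding good_def covered_def rql by simp
  qed
  then obtain T where T: "\<And>s. s \<in> S1 \<Longrightarrow> good s (T s)" by metis
  define comp where "comp = (\<lambda>(r, q, l :: nat) (r', q', l' :: nat). (r + q * r', q * q' :: nat, l'))"
  define S' where "S' = (\<Union>s\<in>S1. comp s ` T s)"
  have H0: "0 < real H" using H by simp
  \<comment> \<open>This keeps the new constant independent of the exponents.\<close>
  have Cpow: "C powr x \<le> C" if "x \<le> 1" for x using powr_mono[of x 1 C] that C by simp
  have finT: "finite (T s)" if "s \<in> S1" for s using T[OF that] by (auto simp: good_def split: prod.splits)
  have len: "real l powr x \<le> C * real H powr (\<eta> * x)" if "(r, q, l) \<in> S1" "0 \<le> x" "x \<le> 1" for r q l x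
  proof -
    have "real l powr x \<le> (C * real H powr \<eta>) powr x"
      using S(3)[of r q l] that S1 by (intro powr_mono2) auto
    also have "\<dots> = C powr x * real H powr (\<eta> * x)" using C by (simp add: powr_mult powr_powr)
    also have "\<dots> \<le> C * real H powr (\<eta> * x)" using Cpow that by (intro mult_right_mono) auto
    finally show ?thesis .
  qed
  have cardT: "real (card (T s)) \<le> C' * (C * real H powr (\<eta> * (1 - \<eta>')))" if s: "s \<in> S1" for s
  proof -
    obtain r q l where rql: "s = (r, q, l)" by (cases s) auto
    have "real (card (T s)) \<le> C' * real l powr (1 - \<eta>')" using T[OF s] by (auto simp: good_def rql)
    also have "\<dots> \<le> C' * (C * real H powr (\<eta> * (1 - \<eta>')))"
      using len[of r q l "1 - \<eta>'"] s \<eta>' C' rql by (intro mult_left_mono) auto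
    finally show ?thesis .
  qed
  have "card S' \<le> (\<Sum>s\<in>S1. card (comp s ` T s))" unfolding S'_def by (rule card_UN_le[OF S1(1)])
  also have "\<dots> \<le> (\<Sum>s\<in>S1. card (T s))" using finT by (intro sum_mono card_image_le) auto
  finally have "real (card S') \<le> (\<Sum>s\<in>S1. real (card (T s)))" by (simp flip: of_nat_sum)
  also have "\<dots> \<le> (\<Sum>s\<in>S1. C' * (C * real H powr (\<eta> * (1 - \<eta>'))))" by (intro sum_mono cardT)
  also have "\<dots> = real (card S1) * (C' * (C * real H powr (\<eta> * (1 - \<eta>'))))" by simp
  also have "real (card S1) \<le> C * real H powr (1 - \<eta>)"
    using card_mono[OF S(1) S1(2)] S(2) by linarith
  hence "real (card S1) * (C' * (C * real H powr (\<eta> * (1 - \<eta>')))) \<le>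
      C * real H powr (1 - \<eta>) * (C' * (C * real H powr (\<eta> * (1 - \<eta>'))))"
    using C C' by (intro mult_right_mono) auto
  also have "\<dots> = C\<^sup>2 * C' * (real H powr (1 - \<eta>) * real H powr (\<eta> * (1 - \<eta>')))"
    by (simp add: power2_eq_square mult_ac)
  also have "real H powr (1 - \<eta>) * real H powr (\<eta> * (1 - \<eta>')) = real H powr (1 - \<eta> * \<eta>')"
    by (simp add: algebra_simps flip: powr_add)
  finally have card: "real (card S') \<le> C\<^sup>2 * C' * real H powr (1 - \<eta> * \<eta>')" .
  have mem: "real l' \<le> C\<^sup>2 * C' * real H powr (\<eta> * \<eta>') \<and> (\<forall>i<l'. r0 + q0 * i < H) \<and> Q r0 q0 l'"
    if "(r0, q0, l') \<in> S'" for r0 q0 l'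
  proof -
    obtain r q l r' q' where x: "(r, q, l) \<in> S1" "(r', q', l') \<in> T (r, q, l)" "r0 = r + q * r'" "q0 = q * q'"
    proof -
      obtain s t where st: "s \<in> S1" "t \<in> T s" "(r0, q0, l') = comp s t"
        using \<open>(r0, q0, l') \<in> S'\<close> unfolding S'_def by blast
      obtain r q l r' q' l'' where "s = (r, q, l)" "t = (r', q', l'')" by (cases s, cases t) auto
      thus thesis using st by (intro that) (auto simp: comp_def)
    qed
    have g: "real l' \<le> C' * real l powr \<eta>'" "\<And>i. i < l' \<Longrightarrow> r' + q' * i < l" "Q r0 q0 l'"
      using T[OF x(1)] x(2-) by (auto simp: good_def)
    have "real l' \<le> C' * (C * real H powr (\<eta> * \<eta>'))"
      using g(1) len[OF x(1) \<eta>'] C' by (meson mult_left_mono order_trans zero_le_one)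
    also have "\<dots> \<le> C' * (C\<^sup>2 * real H powr (\<eta> * \<eta>'))"
      using C C' by (intro mult_left_mono mult_right_mono) (auto simp: power2_eq_square)
    finally have "real l' \<le> C\<^sup>2 * C' * real H powr (\<eta> * \<eta>')" by (simp add: mult_ac)
    moreover have "r0 + q0 * i < H" if "i < l'" for i
    proof -
      have "r + q * (r' + q' * i) < H" using S(3)[of r q l] S1 x(1) g(2)[OF that] by blast
      thus ?thesis by (simp add: x algebra_simps)
    qed
    ultimately show ?thesis using g by blast
  qed
  have cov: "\<exists>(r, q, l)\<in>S'. \<exists>i<l. h = r + q * i" if h: "h < H" for h
  proof -
    obtain r q l i where x: "(r, q, l) \<in> S" "i < l" "h = r + q * i" using S(4)[OF h] by fast
    hence xs: "(r, q, l) \<in> S1" by (auto simp: S1_def)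
    obtain r' q' l' i' where y: "(r', q', l') \<in> T (r, q, l)" "i' < l'" "i = r' + q' * i'"
      using T[OF xs] x(2) by (auto simp: good_def)
    have "(r + q * r', q * q', l') \<in> S'" using xs y by (force simp: S'_def comp_def)
    moreover have "h = (r + q * r') + (q * q') * i'" using x y by (simp add: algebra_simps)
    ultimately show ?thesis using y(2) by fast
  qed
  have "finite S'" using S1 finT by (auto simp: S'_def)
  thus ?thesis unfolding covered_def using card mem cov by (intro exI[of _ S']) auto
qed

text \<open>Each of the q residue classes is cut into blocks of M consecutive terms. Rounding up
  costs one block per class, hence the summand q beside L / M.\<close>

lemma covered_residue_blocks:
  assumes q: "1 \<le> q" and M: "1 \<le> M" and card: "real L / real M + real q \<le> C * real L powr (1 - \<eta>)"
    and len: "real M \<le> C * real L powr \<eta>"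
  shows "covered \<eta> C L (\<lambda>r q' l. q' = q \<and> l \<le> M)"
proof -
  \<comment> \<open>The length of the block starting at a, truncated where it would leave the
    interval; it is 0 if a itself lies outside.\<close>
  define len where "len = (\<lambda>a. LEAST i. i = M \<or> L \<le> a + q * i)"
  have len1: "len a = M \<or> L \<le> a + q * len a" for a
    unfolding len_def by (rule LeastI[of _ M]) simp
  have len2: "len a \<le> M" for a unfolding len_def by (rule Least_le) simp
  have len3: "a + q * i < L" if "i < len a" for a i
    using not_less_Least[OF that[unfolded len_def]] by auto
  define S where "S = (\<lambda>(r, j). (r + q * M * j, q, len (r + q * M * j))) ` ({..<q} \<times> {..L div (q * M)})"
  have "card S \<le> card ({..<q} \<times> {..L div (q * M)})" unfolding S_def by (rule card_image_le) auto
  also have "\<dots> = q * (L div (q * M) + 1)" by (simp add: card_cartesian_product)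
  finally have "real (card S) \<le> real (q * (L div (q * M) + 1))" by (rule of_nat_mono)
  also have "\<dots> = real q * (real (L div (q * M)) + 1)" by (simp add: algebra_simps)
  also have "\<dots> \<le> real q * (real L / real (q * M) + 1)"
    by (intro mult_left_mono add_mono of_nat_div_le_of_nat) auto
  also have "\<dots> = real L / real M + real q" using q by (simp add: field_simps)
  finally have "real (card S) \<le> C * real L powr (1 - \<eta>)" using card by linarith
  moreover have "\<exists>(r, q, l)\<in>S. \<exists>i<l. h = r + q * i" if h: "h < L" for h
  proof -
    define r where "r = h mod q"
    define j where "j = h div (q * M)"
    define i where "i = (h div q) mod M"
    have "M * j + i = h div q" by (simp add: j_def i_def div_mult2_eq)
    hence "h = q * (M * j + i) + r" by (simp add: r_def)
    hence hh: "h = (r + q * M * j) + q * i" by (simp add: algebra_simps)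
    have iM: "i < M" using M by (simp add: i_def)
    have "i < len (r + q * M * j)"
    proof (rule ccontr)
      assume c: "\<not> i < len (r + q * M * j)"
      hence "L \<le> (r + q * M * j) + q * len (r + q * M * j)" using len1[of "r + q * M * j"] iM by auto
      also have "\<dots> \<le> (r + q * M * j) + q * i" using c by simp
      finally show False using hh h by simp
    qed
    moreover have "(r + q * M * j, q, len (r + q * M * j)) \<in> S"
      using q h unfolding S_def r_def j_def by (force intro!: div_le_mono)
    ultimately show ?thesis using hh by fast
  qed
  moreover have "real (len a) \<le> C * real L powr \<eta>" for a
    using len2[of a] assms(4) by linarith
  ultimately show ?thesis unfolding covered_def using len2 len3
    by (intro exI[of _ S]) (auto simp: S_def)
qed

text \<open>The exponent 1 / (K + 1) balances the two terms of the block count: for a step of size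
  about M^K, both L / M and the step are of order L^(1-\<eta>).\<close>

lemma powr_block_size:
  fixes L K :: nat
  assumes L: "1 \<le> L"
  defines "M \<equiv> nat \<lfloor>real L powr (1 / (real K + 1))\<rfloor>"
  shows "1 \<le> M" "real M \<le> real L powr (1 / (real K + 1))"
    "real L / real M \<le> 2 * real L powr (1 - 1 / (real K + 1))"
    "real M ^ K \<le> real L powr (1 - 1 / (real K + 1))"
proof -
  define \<eta> where "\<eta> = 1 / (real K + 1)"
  have Leta: "1 \<le> real L powr \<eta>" using L by (intro ge_one_powr_ge_zero) (auto simp: \<eta>_def)
  show M1: "1 \<le> M" and M2: "real M \<le> real L powr (1 / (real K + 1))"
    using Leta unfolding M_def \<eta>_def by linarith+
  have M3: "real L powr \<eta> / 2 \<le> real M" using Leta M1 unfolding M_def \<eta>_def by linarith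
  have "real L / real M \<le> real L / (real L powr \<eta> / 2)"
    using M3 M1 L by (intro divide_left_mono) auto
  also have "\<dots> = 2 * real L powr (1 - \<eta>)" using L by (simp add: powr_diff)
  finally show "real L / real M \<le> 2 * real L powr (1 - 1 / (real K + 1))" by (simp add: \<eta>_def)
  have "real M ^ K \<le> (real L powr \<eta>) ^ K" using M2 by (intro power_mono) (auto simp: \<eta>_def)
  also have "\<dots> = real L powr (\<eta> * real K)" using L by (simp add: powr_powr flip: powr_realpow)
  also have "\<eta> * real K = 1 - \<eta>" by (simp add: \<eta>_def field_simps)
  finally show "real M ^ K \<le> real L powr (1 - 1 / (real K + 1))" by (simp add: \<eta>_def)
qed

section \<open>Approximating real polynomials by integer-valued ones along progressions\<close>

lemma affine_subst_top_coeff: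
  fixes p :: "real poly"
  assumes "degree p \<le> Suc d"
  shows "degree (pcompose p [:a, b:] - monom (b ^ Suc d * coeff p (Suc d)) (Suc d)) \<le> d"
proof (rule degree_le, intro allI impI)
  define P where "P = pcompose p [:a, b:]"
  have "degree P \<le> degree p * degree [:a, b:]" by (simp add: P_def degree_pcompose)
  also have "\<dots> \<le> degree p" by simp
  finally have degP: "degree P \<le> degree p" .
  fix i assume i: "d < i"
  show "coeff (P - monom (b ^ Suc d * coeff p (Suc d)) (Suc d)) i = 0"
  proof (cases "i = Suc d")
    case False
    hence "degree P < i" using degP assms i by linarith
    thus ?thesis using False by (simp add: coeff_eq_0)
  next
    case True
    show ?thesis
    proof (cases "degree p = Suc d \<and> b \<noteq> 0")
      case b: True
      hence "degree P = Suc d" by (simp add: P_def degree_pcompose)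
      moreover have "lead_coeff P = lead_coeff p * b ^ degree p"
        unfolding P_def using b by (subst lead_coeff_comp) auto
      ultimately show ?thesis using True b by (simp add: mult_ac)
    next
      case b: False
      have "coeff P (Suc d) = 0"
      proof (cases "b = 0")
        case True
        hence "degree P = 0" by (simp add: P_def degree_pcompose)
        thus ?thesis by (simp add: coeff_eq_0)
      next
        case False
        thus ?thesis using b assms degP by (intro coeff_eq_0) linarith
      qed
      moreover have "b ^ Suc d * coeff p (Suc d) = 0" using b assms
        by (metis coeff_eq_0 le_neq_implies_less mult_zero_left mult_zero_right power_0_Suc)
      ultimately show ?thesis using True by simp
    qed
  qed
qed

lemma poly_affine: "poly (pcompose p [:real a, real b:]) (real i) = poly p (real (a + b * i))"
  by (simp add: poly_pcompose mult.commute)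

lemma degree_affine: "degree (pcompose p [:a, b:]) \<le> degree (p :: real poly)"
proof -
  have "degree (pcompose p [:a, b:]) = degree p * degree [:a, b:]" by (rule degree_pcompose)
  also have "\<dots> \<le> degree p" by simp
  finally show ?thesis .
qed

text \<open>Induction on the degree. On blocks of at most M terms with a suitable step, the top
  monomial is within 1 of an integer multiple of the same monomial; the rest has smaller degree and
  is treated by refining. Each degree adds 1 to the error.\<close>

lemma poly_near_integer_poly:
  "\<exists>\<eta> C. 0 < \<eta> \<and> \<eta> \<le> 1 \<and> 1 \<le> C \<and> (\<forall>p L. degree p \<le> d \<longrightarrow> 1 \<le> L \<longrightarrow>
     covered \<eta> C L (\<lambda>r q l. \<exists>z. degree z \<le> d \<and> (\<forall>i. poly z (real i) \<in> \<int>) \<and>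
       (\<forall>i<l. \<bar>poly p (real (r + q * i)) - poly z (real i)\<bar> \<le> real d + 1)))"
proof (induction d)
  case 0
  have "covered 1 1 L (\<lambda>r q l. \<exists>z. degree z \<le> 0 \<and> (\<forall>i. poly z (real i) \<in> \<int>) \<and>
       (\<forall>i<l. \<bar>poly p (real (r + q * i)) - poly z (real i)\<bar> \<le> real 0 + 1))"
    if "degree p \<le> 0" "1 \<le> L" for p :: "real poly" and L
  proof (rule covered_trivial[OF that(2)])
    define c where "c = coeff p 0"
    have p: "p = [:c:]" unfolding c_def using that(1) by (simp add: degree_0_id)
    have "\<bar>c - of_int \<lfloor>c\<rfloor>\<bar> \<le> 1" by linarith
    thus "\<exists>z. degree z \<le> 0 \<and> (\<forall>i. poly z (real i) \<in> \<int>) \<and>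
       (\<forall>i<L. \<bar>poly p (real (0 + 1 * i)) - poly z (real i)\<bar> \<le> real 0 + 1)"
      by (intro exI[of _ "[:of_int \<lfloor>c\<rfloor>:]"]) (simp add: p)
  qed
  thus ?case by (intro exI[of _ 1]) auto
next
  case (Suc d)
  then obtain \<eta>' C' where IH: "0 < \<eta>'" "\<eta>' \<le> 1" "1 \<le> C'"
    "\<And>p L. degree p \<le> d \<Longrightarrow> 1 \<le> L \<Longrightarrow>
     covered \<eta>' C' L (\<lambda>r q l. \<exists>z. degree z \<le> d \<and> (\<forall>i. poly z (real i) \<in> \<int>) \<and>
       (\<forall>i<l. \<bar>poly p (real (r + q * i)) - poly z (real i)\<bar> \<le> real d + 1))" by blast
  obtain C K where heil: "1 \<le> C"
    "\<And>\<alpha> M. 1 \<le> M \<Longrightarrow> \<exists>q\<ge>1. real q \<le> C * real M ^ K \<and> real M * dist_int (real q ^ Suc d * \<alpha>) \<le> 1"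
    using heilbronn[of d] by blast
  \<comment> \<open>With M^(d+1) in place of M, Heilbronn's theorem bounds the step by a constant
    times M^k.\<close>
  define k where "k = Suc d * K"
  define \<eta> where "\<eta> = 1 / (real k + 1)"
  have \<eta>: "0 < \<eta>" "\<eta> \<le> 1" by (auto simp: \<eta>_def)
  have "covered (\<eta> * \<eta>') ((C + 2)\<^sup>2 * C') L
      (\<lambda>r q l. \<exists>z. degree z \<le> Suc d \<and> (\<forall>i. poly z (real i) \<in> \<int>) \<and>
       (\<forall>i<l. \<bar>poly p (real (r + q * i)) - poly z (real i)\<bar> \<le> real (Suc d) + 1))"
    if p: "degree p \<le> Suc d" and L: "1 \<le> L" for p L
  proof -
    define \<alpha> where "\<alpha> = coeff p (Suc d)"
    define M where "M = nat \<lfloor>real L powr \<eta>\<rfloor>"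
    note M = powr_block_size[OF L, of k, folded \<eta>_def, folded M_def]
    \<comment> \<open>The precision asked for is M^(-(d+1)), because the top monomial is evaluated
      at arguments up to M.\<close>
    have "1 \<le> M ^ Suc d" using M(1) by simp
    then obtain q where q: "1 \<le> q" "real q \<le> C * real (M ^ Suc d) ^ K"
      "real (M ^ Suc d) * dist_int (real q ^ Suc d * \<alpha>) \<le> 1"
      using heil(2)[of "M ^ Suc d" \<alpha>] by blast
    define m where "m = round (real q ^ Suc d * \<alpha>)"
    have "C * real (M ^ Suc d) ^ K = C * real M ^ k" by (simp only: k_def of_nat_power power_mult)
    hence "real q \<le> C * real L powr (1 - \<eta>)" using q(2) mult_left_mono[OF M(4), of C] heil(1) by linarith
    hence c: "real L / real M + real q \<le> (C + 2) * real L powr (1 - \<eta>)"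
      using M(3) by (simp add: algebra_simps)
    have "1 * real L powr \<eta> \<le> (C + 2) * real L powr \<eta>" using heil(1) by (intro mult_right_mono) auto
    hence "real M \<le> (C + 2) * real L powr \<eta>" using M(2) by linarith
    hence cov: "covered \<eta> (C + 2) L (\<lambda>r q' l. q' = q \<and> l \<le> M)"
      by (rule covered_residue_blocks[OF q(1) M(1) c])
    show ?thesis
    proof (rule covered_refine[OF cov _ IH(3) L less_imp_le[OF IH(1)] IH(2)])
      show "1 \<le> C + 2" using heil(1) by simp
    next
      fix r q1 l assume rl: "q1 = q \<and> l \<le> M" "1 \<le> l"
      define \<beta> where "\<beta> = real q ^ Suc d * \<alpha>"
      define p' where "p' = pcompose p [:real r, real q:] - monom \<beta> (Suc d)"
      have degp': "degree p' \<le> d" unfolding p'_def \<alpha>_def \<beta>_def by (rule affine_subst_top_coeff[OF p])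
      have p': "poly p (real (r + q * i)) = \<beta> * real i ^ Suc d + poly p' (real i)" for i
        unfolding p'_def poly_diff poly_affine by (simp add: poly_monom)
      show "covered \<eta>' C' l (\<lambda>r' q' l'. \<exists>z. degree z \<le> Suc d \<and> (\<forall>i. poly z (real i) \<in> \<int>) \<and>
           (\<forall>i<l'. \<bar>poly p (real (r + q1 * r' + q1 * q' * i)) - poly z (real i)\<bar> \<le> real (Suc d) + 1))"
      proof (rule covered_mono[OF IH(4)[OF degp' rl(2)]])
        fix r' q' l'
        assume "\<exists>z. degree z \<le> d \<and> (\<forall>i. poly z (real i) \<in> \<int>) \<and>
           (\<forall>i<l'. \<bar>poly p' (real (r' + q' * i)) - poly z (real i)\<bar> \<le> real d + 1)"
        then obtain z where z: "degree z \<le> d" "\<And>i. poly z (real i) \<in> \<int>"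
          "\<And>i. i < l' \<Longrightarrow> \<bar>poly p' (real (r' + q' * i)) - poly z (real i)\<bar> \<le> real d + 1" by blast
        assume sub: "\<forall>i<l'. r' + q' * i < l"
        define w where "w = smult (of_int m) ([:real r', real q':] ^ Suc d) + z"
        have pw: "poly w (real i) = of_int m * real (r' + q' * i) ^ Suc d + poly z (real i)" for i
          by (simp add: w_def mult.commute del: power_Suc)
        have "degree ([:real r', real q':] ^ Suc d) \<le> degree [:real r', real q':] * Suc d"
          by (rule degree_power_le)
        also have "\<dots> \<le> 1 * Suc d" by (intro mult_right_mono) auto
        finally have "degree ([:real r', real q':] ^ Suc d) \<le> Suc d" by simp
        hence "degree w \<le> Suc d" unfolding w_def using z(1)
          by (intro degree_add_le order_trans[OF degree_smult_le]) auto
        moreover have "poly w (real i) \<in> \<int>" for i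
          unfolding pw by (intro Ints_add Ints_mult Ints_power z(2)) auto
        moreover have "\<bar>poly p (real (r + q1 * r' + q1 * q' * i)) - poly w (real i)\<bar> \<le> real (Suc d) + 1"
          if i: "i < l'" for i
        proof -
          define n where "n = r' + q' * i"
          have "n < l" "l \<le> M" using sub i rl by (auto simp: n_def)
          hence n: "real n \<le> real M" by simp
          have "r + q1 * r' + q1 * q' * i = r + q * n" using rl by (simp add: n_def algebra_simps)
          hence "poly p (real (r + q1 * r' + q1 * q' * i)) - poly w (real i) =
            (\<beta> - of_int m) * real n ^ Suc d + (poly p' (real n) - poly z (real i))"
            unfolding pw n_def[symmetric] by (simp only: p') (simp add: algebra_simps)
          moreover have "\<bar>(\<beta> - of_int m) * real n ^ Suc d\<bar> \<le> 1"
          proof -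
            have "\<bar>(\<beta> - of_int m) * real n ^ Suc d\<bar> = dist_int \<beta> * real n ^ Suc d"
              by (simp add: abs_mult dist_int_def m_def \<beta>_def)
            also have "\<dots> \<le> dist_int \<beta> * real M ^ Suc d" using n by (intro mult_left_mono power_mono) auto
            finally show ?thesis using q(3) by (simp add: \<beta>_def mult_ac)
          qed
          ultimately show ?thesis using z(3)[OF i] unfolding n_def by linarith
        qed
        ultimately show "\<exists>z. degree z \<le> Suc d \<and> (\<forall>i. poly z (real i) \<in> \<int>) \<and>
           (\<forall>i<l'. \<bar>poly p (real (r + q1 * r' + q1 * q' * i)) - poly z (real i)\<bar> \<le> real (Suc d) + 1)"
          by blast
      qed
    qed
  qed
  moreover have "0 < \<eta> * \<eta>'" using \<eta> IH by simp
  moreover have "\<eta> * \<eta>' \<le> 1" using \<eta> IH by (simp add: mult_le_one)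
  moreover have "1 \<le> (C + 2)\<^sup>2 * C'"
  proof -
    have "1 * 1 \<le> (C + 2)\<^sup>2 * C'" using heil(1) IH(3) by (intro mult_mono one_le_power) auto
    thus ?thesis by simp
  qed
  ultimately show ?case by blast
qed

section \<open>Integer parts of smooth functions\<close>

definition changes :: "(nat \<Rightarrow> 'a) \<Rightarrow> nat \<Rightarrow> nat" where
  "changes v n = (\<Sum>i<n. of_bool (v i \<noteq> v (Suc i)))"

text \<open>The maximal runs of equal values form the covering. For \<eta> = 1 the bound on their
  number is independent of the length, so such a refinement costs nothing in the exponent.\<close>

lemma covered_constant_runs:
  "covered 1 (real (changes v n) + 1) (Suc n) (\<lambda>r q l. q = 1 \<and> (\<forall>i<l. v (r + i) = v r))"
proof -
  define runs where "runs = (\<lambda>n J. finite J \<and> card J \<le> changes v n + 1 \<and>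
      (\<forall>p\<in>J. fst p + snd p \<le> Suc n \<and> (\<forall>i<snd p. v (fst p + i) = v (fst p))) \<and>
      (\<forall>h\<le>n. \<exists>p\<in>J. fst p \<le> h \<and> h < fst p + snd p))"
  \<comment> \<open>The induction also records a run that ends exactly at n, which is the one to be
    extended when the next value is equal.\<close>
  have "\<exists>J. runs n J \<and> (\<exists>p\<in>J. fst p + snd p = Suc n \<and> 1 \<le> snd p)"
  proof (induction n)
    case 0
    show ?case by (intro exI[of _ "{(0, 1)}"]) (auto simp: runs_def)
  next
    case (Suc n)
    then obtain J p where J: "runs n J" and p: "p \<in> J" "fst p + snd p = Suc n" "1 \<le> snd p" by blast
    have fin: "finite J" using J by (simp add: runs_def)
    have const: "v (fst p' + i) = v (fst p')" if "p' \<in> J" "i < snd p'" for p' i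
      using J that by (simp add: runs_def)
    have bnd: "fst p' + snd p' \<le> Suc n" if "p' \<in> J" for p' using J that by (simp add: runs_def)
    show ?case
    proof (cases "v n = v (Suc n)")
      case False
      have "card (insert (Suc n, 1) J) \<le> card J + 1" using fin by (simp add: card_insert_if)
      hence 1: "card (insert (Suc n, 1) J) \<le> changes v (Suc n) + 1"
        using J False by (simp add: changes_def runs_def)
      have 2: "\<exists>p\<in>insert (Suc n, 1) J. fst p \<le> h \<and> h < fst p + snd p" if "h \<le> Suc n" for h
        using J that by (cases "h = Suc n") (auto simp: runs_def)
      have 3: "fst p' + snd p' \<le> Suc (Suc n)" if "p' \<in> insert (Suc n, 1) J" for p'
        using bnd[of p'] that by auto
      have "runs (Suc n) (insert (Suc n, 1) J)"
        unfolding runs_def using 1 2 3 fin const by auto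
      thus ?thesis by (intro exI[of _ "insert (Suc n, 1) J"]) auto
    next
      case True
      define p1 where "p1 = (fst p, Suc (snd p))"
      define J' where "J' = insert p1 (J - {p})"
      have "card J' \<le> Suc (card (J - {p}))" unfolding J'_def using fin by (simp add: card_insert_if)
      also have "\<dots> = card J" using fin p(1) by (rule card.remove[symmetric])
      finally have 1: "card J' \<le> changes v (Suc n) + 1" using J True by (simp add: changes_def runs_def)
      have 3: "v (fst p + i) = v (fst p)" if "i < Suc (snd p)" for i
      proof (cases "i = snd p")
        case False
        thus ?thesis using const[OF p(1), of i] that by auto
      next
        case i: True
        have "n = fst p + (snd p - 1)" using p(2,3) by simp
        hence "v n = v (fst p)" using const[OF p(1), of "snd p - 1"] p(3) by simp
        thus ?thesis using True p(2) i by simp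
      qed
      have 2: "\<exists>p\<in>J'. fst p \<le> h \<and> h < fst p + snd p" if h: "h \<le> Suc n" for h
      proof (cases "h = Suc n")
        case True
        thus ?thesis using p by (intro bexI[of _ p1]) (auto simp: J'_def p1_def)
      next
        case False
        hence "h \<le> n" using h by simp
        then obtain p' where p': "p' \<in> J" "fst p' \<le> h" "h < fst p' + snd p'"
          using J unfolding runs_def by blast
        show ?thesis
        proof (cases "p' = p")
          case True
          thus ?thesis using p' by (intro bexI[of _ p1]) (auto simp: J'_def p1_def)
        next
          case False
          thus ?thesis using p' by (intro bexI[of _ p']) (auto simp: J'_def)
        qed
      qed
      have "runs (Suc n) J'"
        unfolding runs_def using 1 2 fin
      proof (intro conjI ballI allI impI)
        fix p' assume "p' \<in> J'"
        hence "p' = p1 \<or> p' \<in> J" by (auto simp: J'_def)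
        thus "fst p' + snd p' \<le> Suc (Suc n)" using p(2) bnd[of p'] by (auto simp: p1_def)
        show "v (fst p' + i) = v (fst p')" if "i < snd p'" for i
          using \<open>p' = p1 \<or> p' \<in> J\<close> 3[of i] const[of p' i] that by (auto simp: p1_def)
      qed (auto simp: J'_def)
      moreover have "p1 \<in> J'" "fst p1 + snd p1 = Suc (Suc n)" "1 \<le> snd p1"
        using p(2) by (auto simp: p1_def J'_def)
      ultimately show ?thesis by blast
    qed
  qed
  then obtain J where J: "runs n J" by blast
  define S where "S = (\<lambda>p. (fst p, 1::nat, snd p)) ` J"
  have "card S \<le> card J" unfolding S_def using J by (intro card_image_le) (simp add: runs_def)
  hence "real (card S) \<le> (real (changes v n) + 1) * real (Suc n) powr (1 - 1)"
    using J by (simp add: runs_def)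
  moreover have "real (snd p) \<le> (real (changes v n) + 1) * real (Suc n) powr 1" if "p \<in> J" for p
  proof -
    have "fst p + snd p \<le> Suc n" using J that by (simp add: runs_def)
    hence "real (snd p) \<le> 1 * real (Suc n)" by simp
    also have "\<dots> \<le> (real (changes v n) + 1) * real (Suc n)" by (intro mult_right_mono) auto
    finally show ?thesis by simp
  qed
  moreover have "\<exists>(r, q, l)\<in>S. \<exists>i<l. h = r + q * i" if h: "h < Suc n" for h
  proof -
    have "h \<le> n" using h by simp
    then obtain p where p: "p \<in> J" "fst p \<le> h" "h < fst p + snd p" using J unfolding runs_def by blast
    hence "(fst p, 1, snd p) \<in> S" "h - fst p < snd p" "h = fst p + 1 * (h - fst p)"
      by (auto simp: S_def)
    thus ?thesis by blast
  qed
  moreover have "fst p + 1 * i < Suc n" if "p \<in> J" "i < snd p" for p i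
  proof -
    have "fst p + snd p \<le> Suc n" using J that by (simp add: runs_def)
    thus ?thesis using that by simp
  qed
  moreover have "v (fst p + i) = v (fst p)" if "p \<in> J" "i < snd p" for p i
    using J that by (simp add: runs_def)
  moreover have "finite S" using J by (simp add: S_def runs_def)
  ultimately show ?thesis unfolding covered_def by (intro exI[of _ S]) (simp add: S_def)
qed

text \<open>Consecutive changes of s go in opposite directions and t records the direction, so t
  changes between them. The indicator allows for the latest change of s, which no change of t has
  paid for yet.\<close>

lemma changes_le_Suc_aux:
  assumes "\<And>i. i \<le> n \<Longrightarrow> \<not> s i \<Longrightarrow> s (Suc i) \<Longrightarrow> t i" "\<And>i. i \<le> n \<Longrightarrow> s i \<Longrightarrow> \<not> s (Suc i) \<Longrightarrow> \<not> t i"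
  shows "changes s (Suc n) \<le> changes t n + of_bool (t n = s (Suc n))"
  using assms
proof (induction n)
  case 0
  thus ?case by (cases "s 0"; cases "s (Suc 0)"; cases "t 0") (auto simp: changes_def)
next
  case (Suc n)
  have IH: "changes s (Suc n) \<le> changes t n + of_bool (t n = s (Suc n))"
    by (rule Suc.IH) (use Suc.prems in auto)
  have "changes s (Suc (Suc n)) = changes s (Suc n) + of_bool (s (Suc n) \<noteq> s (Suc (Suc n)))"
    "changes t (Suc n) = changes t n + of_bool (t n \<noteq> t (Suc n))"
    by (simp_all add: changes_def)
  thus ?case using IH Suc.prems(1)[of "Suc n"] Suc.prems(2)[of "Suc n"]
    by (cases "s (Suc n)"; cases "s (Suc (Suc n))"; cases "t n"; cases "t (Suc n)") auto
qed

lemma changes_le_Suc: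
  assumes "\<And>i. i < n \<Longrightarrow> \<not> s i \<Longrightarrow> s (Suc i) \<Longrightarrow> t i" "\<And>i. i < n \<Longrightarrow> s i \<Longrightarrow> \<not> s (Suc i) \<Longrightarrow> \<not> t i"
  shows "changes s n \<le> changes t (n - 1) + 1"
proof (cases n)
  case 0
  thus ?thesis by (simp add: changes_def)
next
  case (Suc m)
  have "changes s (Suc m) \<le> changes t m + of_bool (t m = s (Suc m))"
    by (rule changes_le_Suc_aux) (use assms Suc in auto)
  also have "\<dots> \<le> changes t m + 1" by simp
  finally show ?thesis using Suc by simp
qed

section \<open>Crossings of integer levels by smooth functions\<close>

fun iter_diff :: "nat \<Rightarrow> (nat \<Rightarrow> real) \<Rightarrow> nat \<Rightarrow> real" where
  "iter_diff 0 f = f"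
| "iter_diff (Suc k) f = iter_diff k (\<lambda>i. f (Suc i) - f i)"

text \<open>A discrete Rolle theorem: between two sign changes of \<open>f\<close> its difference changes sign.\<close>
lemma sign_changes_le:
  assumes "c \<noteq> 0" "\<And>i. i + Suc k \<le> n \<Longrightarrow> 0 \<le> c * iter_diff (Suc k) f i"
  shows "changes (\<lambda>i. 0 \<le> f i) n \<le> Suc k"
  using assms(2)
proof (induction k arbitrary: f n)
  case 0
  have "changes (\<lambda>i. 0 \<le> f i) n \<le> changes (\<lambda>i. 0 < c) (n - 1) + 1"
  proof (rule changes_le_Suc)
    fix i assume i: "i < n"
    have d: "0 \<le> c * (f (Suc i) - f i)" using 0[of i] i by simp
    show "0 < c" if "\<not> 0 \<le> f i" "0 \<le> f (Suc i)"
      using d that assms(1) by (auto simp: zero_le_mult_iff)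
    show "\<not> 0 < c" if "0 \<le> f i" "\<not> 0 \<le> f (Suc i)"
      using d that assms(1) by (auto simp: zero_le_mult_iff)
  qed
  thus ?case by (simp add: changes_def)
next
  case (Suc k)
  have "changes (\<lambda>i. 0 \<le> f i) n \<le> changes (\<lambda>i. 0 \<le> f (Suc i) - f i) (n - 1) + 1"
    by (rule changes_le_Suc) auto
  also have "changes (\<lambda>i. 0 \<le> f (Suc i) - f i) (n - 1) \<le> Suc k"
    using Suc.prems by (intro Suc.IH) auto
  finally show ?case by simp
qed

text \<open>Replacing every function of the tower by its difference with step 1 gives a tower of the
  same kind on an interval shorter by 1. The mean value theorem expresses the top of the new tower
  through the next derivative of the old one.\<close>

lemma iter_diff_sign:
  assumes "\<And>j t. j < k \<Longrightarrow> 0 \<le> t \<Longrightarrow> t \<le> real n \<Longrightarrow> (Y j has_real_derivative Y (Suc j) t) (at t)"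
    and "\<And>t. 0 \<le> t \<Longrightarrow> t \<le> real n \<Longrightarrow> 0 \<le> c * Y k t" and "i + k \<le> n"
  shows "0 \<le> c * iter_diff k (\<lambda>i. Y 0 (real i)) i"
  using assms
proof (induction k arbitrary: Y n)
  case (Suc k)
  define Y' where "Y' = (\<lambda>j t. Y j (t + 1) - Y j t)"
  have "0 \<le> c * iter_diff k (\<lambda>i. Y' 0 (real i)) i"
  proof (rule Suc.IH[where n = "n - 1"])
    have n1: "1 \<le> n" using Suc.prems(3) by simp
    fix t assume t: "0 \<le> t" "t \<le> real (n - 1)"
    hence tn: "t + 1 \<le> real n" using n1 by (simp add: of_nat_diff)
    show "(Y' j has_real_derivative Y' (Suc j) t) (at t)" if "j < k" for j
    proof -
      have "(Y j has_real_derivative Y (Suc j) (t + 1)) (at (t + 1))"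
        using t tn that by (intro Suc.prems(1)) auto
      hence "((\<lambda>t. Y j (t + 1)) has_real_derivative Y (Suc j) (t + 1)) (at t)"
        by (simp add: DERIV_shift)
      moreover have "(Y j has_real_derivative Y (Suc j) t) (at t)"
        using t tn that by (intro Suc.prems(1)) auto
      ultimately show ?thesis unfolding Y'_def by (rule DERIV_diff)
    qed
    have "\<exists>z. t < z \<and> z < t + 1 \<and> Y k (t + 1) - Y k t = (t + 1 - t) * Y (Suc k) z"
      using t tn by (intro MVT2) (auto intro!: Suc.prems(1))
    then obtain z where "t < z" "z < t + 1" "Y' k t = Y (Suc k) z" by (auto simp: Y'_def)
    thus "0 \<le> c * Y' k t" using Suc.prems(2)[of z] t tn by simp
  qed (use Suc.prems(3) in auto)
  thus ?case by (simp add: Y'_def add.commute)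
qed auto

text \<open>When the integer part changes, the larger of its two values is a level reached on one
  side only. There are 2 b + 1 possible levels.\<close>

lemma floor_changes_le:
  fixes y :: "nat \<Rightarrow> real"
  assumes b: "\<And>i. i \<le> n \<Longrightarrow> \<bar>y i\<bar> \<le> real b"
    and k: "\<And>c::int. changes (\<lambda>i. 0 \<le> y i - of_int c) n \<le> k"
  shows "changes (\<lambda>i. \<lfloor>y i\<rfloor>) n \<le> (2 * b + 1) * k"
proof -
  have "changes (\<lambda>i. \<lfloor>y i\<rfloor>) n \<le>
      (\<Sum>i<n. \<Sum>c\<in>{-int b..int b}. of_bool ((0 \<le> y i - of_int c) \<noteq> (0 \<le> y (Suc i) - of_int c)))"
    unfolding changes_def
  proof (rule sum_mono)
    fix i assume i: "i \<in> {..<n}"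
    show "of_bool (\<lfloor>y i\<rfloor> \<noteq> \<lfloor>y (Suc i)\<rfloor>) \<le>
      (\<Sum>c\<in>{-int b..int b}. of_bool ((0 \<le> y i - of_int c) \<noteq> (0 \<le> y (Suc i) - of_int c)) :: nat)"
    proof (cases "\<lfloor>y i\<rfloor> = \<lfloor>y (Suc i)\<rfloor>")
      case False
      define c where "c = max \<lfloor>y i\<rfloor> \<lfloor>y (Suc i)\<rfloor>"
      have "\<bar>y i\<bar> \<le> real b" "\<bar>y (Suc i)\<bar> \<le> real b" using i b[of i] b[of "Suc i"] by auto
      hence "c \<in> {-int b..int b}" unfolding c_def by (auto simp: le_floor_iff floor_le_iff max_def)
      moreover have "(0 \<le> y i - of_int c) \<noteq> (0 \<le> y (Suc i) - of_int c)"
        using False unfolding c_def by (auto simp: max_def le_floor_iff split: if_splits) linarith+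
      ultimately show ?thesis
        by (subst sum.remove[of _ c]) auto
    qed simp
  qed
  also have "\<dots> = (\<Sum>c\<in>{-int b..int b}. changes (\<lambda>i. 0 \<le> y i - of_int c) n)"
    unfolding changes_def by (rule sum.swap)
  also have "\<dots> \<le> (\<Sum>c\<in>{-int b..int b}. k)" by (intro sum_mono k)
  also have "\<dots> = card {-int b..int b} * k" by simp
  also have "card {-int b..int b} = 2 * b + 1" by simp
  finally show ?thesis .
qed

lemma higher_pderiv_eq_0:
  assumes "degree (p :: real poly) \<le> d"
  shows "(pderiv ^^ Suc d) p = 0"
  using assms
proof (induction d arbitrary: p)
  case 0
  thus ?case by (simp add: pderiv_eq_0_iff)
next
  case (Suc d)
  have "degree (pderiv p) \<le> d" using Suc.prems by (simp add: degree_pderiv)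
  hence "(pderiv ^^ Suc d) (pderiv p) = 0" by (rule Suc.IH)
  thus ?case by (simp add: funpow_Suc_right del: funpow.simps)
qed

text \<open>The derivative of order d + 1 does not see z, and the affine substitution multiplies it
  by q^(d+1), which preserves its sign. Hence the bound depends neither on z nor on the
  progression.\<close>

lemma sign_changes_smooth_minus_poly:
  assumes c: "c \<noteq> 0" and z: "degree z \<le> d" and l: "\<And>t. 0 \<le> t \<Longrightarrow> t \<le> real n \<Longrightarrow> real r + real q * t \<le> H"
    and deriv: "\<And>j t. j \<le> d \<Longrightarrow> 0 \<le> t \<Longrightarrow> t \<le> H \<Longrightarrow> (G j has_real_derivative G (Suc j) t) (at t)"
    and sign: "\<And>t. 0 \<le> t \<Longrightarrow> t \<le> H \<Longrightarrow> 0 \<le> c * G (Suc d) t"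
  shows "changes (\<lambda>i. 0 \<le> G 0 (real (r + q * i)) - poly z (real i)) n \<le> Suc d"
proof (rule sign_changes_le[OF c])
  fix i assume i: "i + Suc d \<le> n"
  define Y where "Y = (\<lambda>j t. real q ^ j * G j (real r + real q * t) - poly ((pderiv ^^ j) z) t)"
  have "0 \<le> c * iter_diff (Suc d) (\<lambda>i. Y 0 (real i)) i"
  proof (rule iter_diff_sign[OF _ _ i])
    fix t assume t: "0 \<le> t" "t \<le> real n"
    have rt: "0 \<le> real r + real q * t" "real r + real q * t \<le> H" using t l by auto
    show "(Y j has_real_derivative Y (Suc j) t) (at t)" if "j < Suc d" for j
    proof -
      have "(G j has_real_derivative G (Suc j) (real r + real q * t)) (at (real r + real q * t))"
        using that rt by (intro deriv) auto
      moreover have "((\<lambda>t. real r + real q * t) has_real_derivative real q) (at t)"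
        by (auto intro!: derivative_eq_intros)
      ultimately have "((\<lambda>t. G j (real r + real q * t)) has_real_derivative
          G (Suc j) (real r + real q * t) * real q) (at t)"
        by (rule DERIV_chain2)
      thus ?thesis unfolding Y_def
        by (auto intro!: derivative_eq_intros poly_DERIV[THEN DERIV_cong])
    qed
    have "Y (Suc d) t = real q ^ Suc d * G (Suc d) (real r + real q * t)"
      unfolding Y_def higher_pderiv_eq_0[OF z] by simp
    hence "c * Y (Suc d) t = real q ^ Suc d * (c * G (Suc d) (real r + real q * t))" by simp
    moreover have "0 \<le> real q ^ Suc d * (c * G (Suc d) (real r + real q * t))"
      by (intro mult_nonneg_nonneg sign rt zero_le_power) simp
    ultimately show "0 \<le> c * Y (Suc d) t" by (simp only:)
  qed
  thus "0 \<le> c * iter_diff (Suc d) (\<lambda>i. G 0 (real (r + q * i)) - poly z (real i)) i"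
    by (simp add: Y_def)
qed

lemma taylor_poly:
  fixes G :: "nat \<Rightarrow> real \<Rightarrow> real"
  assumes deriv: "\<And>j t. j \<le> d \<Longrightarrow> 0 \<le> t \<Longrightarrow> t \<le> H \<Longrightarrow> (G j has_real_derivative G (Suc j) t) (at t)"
    and small: "\<And>t. 0 \<le> t \<Longrightarrow> t \<le> H \<Longrightarrow> \<bar>G (Suc d) t\<bar> * H ^ Suc d \<le> 1"
  obtains p where "degree p \<le> d" "\<And>h. 0 \<le> h \<Longrightarrow> h \<le> H \<Longrightarrow> \<bar>G 0 h - poly p h\<bar> \<le> 1"
proof
  define p where "p = (\<Sum>m\<le>d. monom (G m 0 / fact m) m)"
  show "degree p \<le> d" unfolding p_def
    by (intro degree_sum_le) (auto intro: order_trans[OF degree_monom_le])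
  have pp: "poly p h = (\<Sum>m<Suc d. G m 0 / fact m * h ^ m)" for h
    by (simp add: p_def poly_sum poly_monom lessThan_Suc_atMost)
  fix h :: real assume h: "0 \<le> h" "h \<le> H"
  show "\<bar>G 0 h - poly p h\<bar> \<le> 1"
  proof (cases "h = 0")
    case True
    have "poly p 0 = (\<Sum>m\<in>{0}. G m 0 / fact m * 0 ^ m)"
      unfolding pp by (intro sum.mono_neutral_right) auto
    thus ?thesis using True by simp
  next
    case False
    hence "\<exists>t>0. t < h \<and> G 0 h = (\<Sum>m<Suc d. G m 0 / fact m * h ^ m) + G (Suc d) t / fact (Suc d) * h ^ Suc d"
      using h by (intro Maclaurin) (auto intro!: deriv)
    then obtain t where t: "0 < t" "t < h" "G 0 h = poly p h + G (Suc d) t / fact (Suc d) * h ^ Suc d"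
      unfolding pp by blast
    have "\<bar>G 0 h - poly p h\<bar> = \<bar>G (Suc d) t\<bar> * h ^ Suc d / fact (Suc d)"
      using t h by (simp add: abs_mult del: fact_Suc)
    also have "\<dots> \<le> \<bar>G (Suc d) t\<bar> * h ^ Suc d / 1"
      using h by (intro divide_left_mono fact_ge_1 mult_nonneg_nonneg) auto
    also have "\<dots> \<le> \<bar>G (Suc d) t\<bar> * H ^ Suc d / 1"
      using h by (intro divide_right_mono mult_left_mono power_mono) auto
    also have "\<dots> \<le> 1" using small[of t] t h by simp
    finally show ?thesis .
  qed
qed

text \<open>\<open>G j\<close> is the \<open>j\<close>-th derivative of \<open>G 0\<close>. The bound on \<open>G (Suc d)\<close> says that on \<open>[0, H]\<close> the
  function \<open>G 0\<close> is within distance 1 of a polynomial of degree at most \<open>d\<close>; the sign condition controls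
  the error term where that polynomial is an integer.\<close>
definition tame :: "nat \<Rightarrow> nat \<Rightarrow> (nat \<Rightarrow> real \<Rightarrow> real) \<Rightarrow> bool" where
  "tame d H G \<longleftrightarrow> (\<exists>c. c \<noteq> 0 \<and>
     (\<forall>j t. j \<le> d \<longrightarrow> 0 \<le> t \<longrightarrow> t \<le> real H \<longrightarrow> (G j has_real_derivative G (Suc j) t) (at t)) \<and>
     (\<forall>t. 0 \<le> t \<longrightarrow> t \<le> real H \<longrightarrow> 0 \<le> c * G (Suc d) t \<and> \<bar>G (Suc d) t\<bar> * real H ^ Suc d \<le> 1))"

lemma floor_tame_covered:
  "\<exists>\<eta> C. 0 < \<eta> \<and> \<eta> \<le> 1 \<and> 1 \<le> C \<and> (\<forall>G H. 1 \<le> H \<longrightarrow> tame d H G \<longrightarrow>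
     covered \<eta> C H (\<lambda>r q l. \<exists>p. degree p \<le> d \<and>
       (\<forall>i<l. of_int \<lfloor>G 0 (real (r + q * i))\<rfloor> = poly p (real i))))"
proof -
  obtain \<eta> C where near: "0 < \<eta>" "\<eta> \<le> 1" "1 \<le> C" "\<And>p L. degree p \<le> d \<Longrightarrow> 1 \<le> L \<Longrightarrow>
     covered \<eta> C L (\<lambda>r q l. \<exists>z. degree z \<le> d \<and> (\<forall>i. poly z (real i) \<in> \<int>) \<and>
       (\<forall>i<l. \<bar>poly p (real (r + q * i)) - poly z (real i)\<bar> \<le> real d + 1))"
    using poly_near_integer_poly[of d] by blast
  \<comment> \<open>The remainder is at most d + 2 in absolute value, 1 from Taylor's formula and d
    + 1 from the integer-valued approximation. So there are 2 (d + 2) + 1 levels, each crossed at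
    most d + 1 times.\<close>
  define m where "m = (2 * (d + 2) + 1) * Suc d"
  have "covered (\<eta> * 1) (C\<^sup>2 * (real m + 1)) H (\<lambda>r q l. \<exists>p. degree p \<le> d \<and>
       (\<forall>i<l. real_of_int \<lfloor>G 0 (real (r + q * i))\<rfloor> = poly p (real i)))"
    if H: "1 \<le> H" and tame: "tame d H G" for G H
  proof -
    obtain c where c: "c \<noteq> 0"
      and deriv: "\<And>j t. j \<le> d \<Longrightarrow> 0 \<le> t \<Longrightarrow> t \<le> real H \<Longrightarrow> (G j has_real_derivative G (Suc j) t) (at t)"
      and G: "\<And>t. 0 \<le> t \<Longrightarrow> t \<le> real H \<Longrightarrow> 0 \<le> c * G (Suc d) t \<and> \<bar>G (Suc d) t\<bar> * real H ^ Suc d \<le> 1"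
      using tame unfolding tame_def by blast
    obtain p where p: "degree p \<le> d" "\<And>h. 0 \<le> h \<Longrightarrow> h \<le> real H \<Longrightarrow> \<bar>G 0 h - poly p h\<bar> \<le> 1"
      using taylor_poly[of d "real H" G] deriv G by blast
    show ?thesis
    proof (rule covered_refine[OF near(4)[OF p(1) H] near(3) _ H])
      fix r q l
      assume "\<exists>z. degree z \<le> d \<and> (\<forall>i. poly z (real i) \<in> \<int>) \<and>
        (\<forall>i<l. \<bar>poly p (real (r + q * i)) - poly z (real i)\<bar> \<le> real d + 1)"
      then obtain z where z: "degree z \<le> d" "\<And>i. poly z (real i) \<in> \<int>"
        "\<And>i. i < l \<Longrightarrow> \<bar>poly p (real (r + q * i)) - poly z (real i)\<bar> \<le> real d + 1" by blast
      assume l: "1 \<le> l" and sub: "\<forall>i<l. r + q * i < H"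
      define n where "n = l - 1"
      have ln: "l = Suc n" using l by (simp add: n_def)
      define y where "y = (\<lambda>i. G 0 (real (r + q * i)) - poly z (real i))"
      have rn: "real r + real q * t \<le> real H" if "0 \<le> t" "t \<le> real n" for t
      proof -
        have "real r + real q * t \<le> real r + real q * real n" using that by (intro add_mono mult_left_mono) auto
        also have "\<dots> = real (r + q * n)" by simp
        also have "\<dots> \<le> real H" using sub ln by (intro of_nat_mono) (simp add: less_imp_le)
        finally show ?thesis .
      qed
      have "changes (\<lambda>i. \<lfloor>y i\<rfloor>) n \<le> m" unfolding m_def
      proof (rule floor_changes_le)
        fix i assume i: "i \<le> n"
        hence "r + q * i < H" using sub ln by simp
        hence "real (r + q * i) \<le> real H" by (intro of_nat_mono less_imp_le)
        hence "\<bar>G 0 (real (r + q * i)) - poly p (real (r + q * i))\<bar> \<le> 1" by (intro p(2)) auto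
        thus "\<bar>y i\<bar> \<le> real (d + 2)" using z(3)[of i] i ln unfolding y_def by simp
      next
        fix k :: int
        \<comment> \<open>The level k is absorbed into the polynomial, so that crossing it becomes a
          sign change.\<close>
        have "degree (z + [:of_int k:]) \<le> d" using z(1) by (intro degree_add_le) auto
        hence "changes (\<lambda>i. 0 \<le> G 0 (real (r + q * i)) - poly (z + [:of_int k:]) (real i)) n \<le> Suc d"
        proof (rule sign_changes_smooth_minus_poly[where H = "real H", OF c])
          show "0 \<le> c * G (Suc d) t" if "0 \<le> t" "t \<le> real H" for t using G[OF that] by blast
        qed (fact rn deriv)+
        thus "changes (\<lambda>i. 0 \<le> y i - of_int k) n \<le> Suc d" by (simp add: y_def diff_diff_eq)
      qed
      hence "covered 1 (real m + 1) l (\<lambda>r q l. q = 1 \<and> (\<forall>i<l. \<lfloor>y (r + i)\<rfloor> = \<lfloor>y r\<rfloor>))"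
        unfolding ln by (intro covered_mono_const[OF covered_constant_runs]) simp
      thus "covered 1 (real m + 1) l (\<lambda>r' q' l'. \<exists>p. degree p \<le> d \<and>
        (\<forall>i<l'. of_int \<lfloor>G 0 (real (r + q * r' + q * q' * i))\<rfloor> = poly p (real i)))"
      proof (rule covered_mono)
        fix a q' l' :: nat assume a: "q' = 1 \<and> (\<forall>i<l'. \<lfloor>y (a + i)\<rfloor> = \<lfloor>y a\<rfloor>)"
        define w where "w = pcompose z [:real a, real 1:] + [:of_int \<lfloor>y a\<rfloor>:]"
        have "degree w \<le> d" unfolding w_def
          using z(1) degree_affine[of z "real a" "real 1"] by (intro degree_add_le) auto
        moreover have "of_int \<lfloor>G 0 (real (r + q * a + q * q' * i))\<rfloor> = poly w (real i)" if i: "i < l'" for i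
        proof -
          obtain k where k: "poly z (real (a + i)) = of_int k" using z(2) Ints_cases by blast
          have e: "r + q * a + q * q' * i = r + q * (a + i)" using a by (simp add: algebra_simps)
          have "G 0 (real (r + q * a + q * q' * i)) = y (a + i) + of_int k" unfolding e y_def k by simp
          hence "\<lfloor>G 0 (real (r + q * a + q * q' * i))\<rfloor> = \<lfloor>y a\<rfloor> + k" using a i by simp
          moreover have "poly w (real i) = of_int k + of_int \<lfloor>y a\<rfloor>"
            unfolding w_def poly_add poly_affine by (simp flip: k)
          ultimately show ?thesis by simp
        qed
        ultimately show "\<exists>p. degree p \<le> d \<and>
          (\<forall>i<l'. of_int \<lfloor>G 0 (real (r + q * a + q * q' * i))\<rfloor> = poly p (real i))" by blast
      qed
    qed auto
  qed
  moreover have "1 \<le> C\<^sup>2 * (real m + 1)"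
  proof -
    have "1 * 1 \<le> C\<^sup>2 * (real m + 1)" using near(3) by (intro mult_mono one_le_power) auto
    thus ?thesis by simp
  qed
  ultimately show ?thesis using near(1,2) by (intro exI[of _ "\<eta> * 1"] exI[of _ "C\<^sup>2 * (real m + 1)"]) auto
qed

section \<open>Generalised polynomials along polynomials\<close>

text \<open>The order of the quantifiers is essential: \<eta>, C and E serve all polynomials of
  degree at most D, so the property can be invoked afresh on every progression of a
  covering.\<close>

definition pw_poly_on :: "(real \<Rightarrow> real) \<Rightarrow> nat \<Rightarrow> bool" where
  "pw_poly_on g D \<longleftrightarrow> (\<exists>\<eta> C E. 0 < \<eta> \<and> \<eta> \<le> 1 \<and> 1 \<le> C \<and> (\<forall>p H. degree p \<le> D \<longrightarrow> 1 \<le> H \<longrightarrow>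
     covered \<eta> C H (\<lambda>r q l. \<exists>p'. degree p' \<le> E \<and>
       (\<forall>i<l. g (poly p (real (r + q * i))) = poly p' (real i)))))"

lemma pw_poly_onI:
  assumes "0 < \<eta>" "\<eta> \<le> 1" "1 \<le> C"
    "\<And>p H. degree p \<le> D \<Longrightarrow> 1 \<le> H \<Longrightarrow> covered \<eta> C H (\<lambda>r q l. \<exists>p'. degree p' \<le> E \<and>
       (\<forall>i<l. g (poly p (real (r + q * i))) = poly p' (real i)))"
  shows "pw_poly_on g D"
  unfolding pw_poly_on_def
  by (rule exI[of _ \<eta>], rule exI[of _ C], rule exI[of _ E]) (use assms in simp)

lemma refined_const_ge_1: "1 \<le> C \<Longrightarrow> 1 \<le> C' \<Longrightarrow> 1 \<le> C\<^sup>2 * (C' :: real)"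
  using mult_mono[of 1 "C\<^sup>2" 1 C'] by (simp add: one_le_power)

lemma pw_poly_on_binop:
  assumes f: "pw_poly_on f D" and g: "pw_poly_on g D"
    and op: "\<And>p q x. poly (P p q) x = F (poly p x) (poly q x)"
    and deg: "\<And>p q. degree (P p q) \<le> degree p + degree q"
  shows "pw_poly_on (\<lambda>x. F (f x) (g x)) D"
proof -
  obtain \<eta> C E where F: "0 < \<eta>" "\<eta> \<le> 1" "1 \<le> C" "\<And>p H. degree p \<le> D \<Longrightarrow> 1 \<le> H \<Longrightarrow>
     covered \<eta> C H (\<lambda>r q l. \<exists>p'. degree p' \<le> E \<and> (\<forall>i<l. f (poly p (real (r + q * i))) = poly p' (real i)))"
    using f unfolding pw_poly_on_def by blast
  obtain \<eta>' C' E' where G: "0 < \<eta>'" "\<eta>' \<le> 1" "1 \<le> C'" "\<And>p H. degree p \<le> D \<Longrightarrow> 1 \<le> H \<Longrightarrow>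
     covered \<eta>' C' H (\<lambda>r q l. \<exists>p'. degree p' \<le> E' \<and> (\<forall>i<l. g (poly p (real (r + q * i))) = poly p' (real i)))"
    using g unfolding pw_poly_on_def by blast
  show ?thesis
  proof (rule pw_poly_onI[where \<eta> = "\<eta> * \<eta>'" and C = "C\<^sup>2 * C'" and E = "E + E'"])
    fix p :: "real poly" and H :: nat assume p: "degree p \<le> D" and H: "1 \<le> H"
    show "covered (\<eta> * \<eta>') (C\<^sup>2 * C') H (\<lambda>r q l. \<exists>p'. degree p' \<le> E + E' \<and>
       (\<forall>i<l. F (f (poly p (real (r + q * i)))) (g (poly p (real (r + q * i)))) = poly p' (real i)))"
    proof (rule covered_refine[OF F(4)[OF p H] F(3) G(3) H less_imp_le[OF G(1)] G(2)])
      fix r q l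
      assume "\<exists>p'. degree p' \<le> E \<and> (\<forall>i<l. f (poly p (real (r + q * i))) = poly p' (real i))" and l: "1 \<le> l"
      then obtain p1 where p1: "degree p1 \<le> E" "\<And>i. i < l \<Longrightarrow> f (poly p (real (r + q * i))) = poly p1 (real i)"
        by blast
      \<comment> \<open>Reparametrising p along a progression changes its coefficients but does not
        raise its degree, so the covering for g is available there with the same constants.\<close>
      have "degree (pcompose p [:real r, real q:]) \<le> D" using degree_affine p by (rule order_trans)
      from G(4)[OF this l]
      show "covered \<eta>' C' l (\<lambda>r' q' l'. \<exists>p'. degree p' \<le> E + E' \<and>
        (\<forall>i<l'. F (f (poly p (real (r + q * r' + q * q' * i)))) (g (poly p (real (r + q * r' + q * q' * i)))) =
           poly p' (real i)))"
      proof (rule covered_mono)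
        fix r' q' l'
        assume "\<exists>p'. degree p' \<le> E' \<and> (\<forall>i<l'. g (poly (pcompose p [:real r, real q:]) (real (r' + q' * i))) = poly p' (real i))"
        then obtain p2 where p2: "degree p2 \<le> E'"
          "\<And>i. i < l' \<Longrightarrow> g (poly p (real (r + q * (r' + q' * i)))) = poly p2 (real i)"
          unfolding poly_affine by blast
        assume sub: "\<forall>i<l'. r' + q' * i < l"
        have "degree (P (pcompose p1 [:real r', real q':]) p2) \<le> E + E'"
          using p1(1) p2(1) degree_affine[of p1 "real r'" "real q'"]
          by (intro order_trans[OF deg] add_mono) auto
        moreover have "F (f (poly p (real (r + q * r' + q * q' * i)))) (g (poly p (real (r + q * r' + q * q' * i)))) =
           poly (P (pcompose p1 [:real r', real q':]) p2) (real i)" if i: "i < l'" for i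
        proof -
          have "r + q * r' + q * q' * i = r + q * (r' + q' * i)" by (simp add: algebra_simps)
          moreover have "r' + q' * i < l" using sub i by blast
          ultimately show ?thesis by (simp only: op poly_affine p1(2) p2(2)[OF i])
        qed
        ultimately show "\<exists>p'. degree p' \<le> E + E' \<and>
          (\<forall>i<l'. F (f (poly p (real (r + q * r' + q * q' * i)))) (g (poly p (real (r + q * r' + q * q' * i)))) =
            poly p' (real i))" by blast
      qed
    qed
  qed (use F(1-3) G(1-3) in \<open>auto simp: mult_le_one refined_const_ge_1\<close>)
qed

lemma pw_poly_on_floor:
  assumes f: "pw_poly_on f D"
  shows "pw_poly_on (\<lambda>x. of_int \<lfloor>f x\<rfloor>) D"
proof -
  obtain \<eta> C E where F: "0 < \<eta>" "\<eta> \<le> 1" "1 \<le> C" "\<And>p H. degree p \<le> D \<Longrightarrow> 1 \<le> H \<Longrightarrow>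
     covered \<eta> C H (\<lambda>r q l. \<exists>p'. degree p' \<le> E \<and> (\<forall>i<l. f (poly p (real (r + q * i))) = poly p' (real i)))"
    using f unfolding pw_poly_on_def by blast
  obtain \<eta>' C' where G: "0 < \<eta>'" "\<eta>' \<le> 1" "1 \<le> C'" "\<And>G H. 1 \<le> H \<Longrightarrow> tame E H G \<Longrightarrow>
     covered \<eta>' C' H (\<lambda>r q l. \<exists>p. degree p \<le> E \<and>
       (\<forall>i<l. of_int \<lfloor>G 0 (real (r + q * i))\<rfloor> = poly p (real i)))"
    using floor_tame_covered[of E] by blast
  show ?thesis
  proof (rule pw_poly_onI[where \<eta> = "\<eta> * \<eta>'" and C = "C\<^sup>2 * C'" and E = E])
    fix p :: "real poly" and H :: nat assume p: "degree p \<le> D" and H: "1 \<le> H"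
    show "covered (\<eta> * \<eta>') (C\<^sup>2 * C') H (\<lambda>r q l. \<exists>p'. degree p' \<le> E \<and>
       (\<forall>i<l. of_int \<lfloor>f (poly p (real (r + q * i)))\<rfloor> = poly p' (real i)))"
    proof (rule covered_refine[OF F(4)[OF p H] F(3) G(3) H less_imp_le[OF G(1)] G(2)])
      fix r q l
      assume "\<exists>p'. degree p' \<le> E \<and> (\<forall>i<l. f (poly p (real (r + q * i))) = poly p' (real i))" and l: "1 \<le> l"
      then obtain p1 where p1: "degree p1 \<le> E" "\<And>i. i < l \<Longrightarrow> f (poly p (real (r + q * i))) = poly p1 (real i)"
        by blast
      have "covered \<eta>' C' l (\<lambda>r q l. \<exists>p. degree p \<le> E \<and>
         (\<forall>i<l. of_int \<lfloor>poly ((pderiv ^^ 0) p1) (real (r + q * i))\<rfloor> = poly p (real i)))"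
      proof (rule G(4)[OF l, where G = "\<lambda>j t. poly ((pderiv ^^ j) p1) t"])
        \<comment> \<open>However large its coefficients, a polynomial of degree at most E is tame,
          since its derivative of order E + 1 vanishes; any nonzero c will do.\<close>
        show "tame E l (\<lambda>j t. poly ((pderiv ^^ j) p1) t)"
          unfolding tame_def higher_pderiv_eq_0[OF p1(1)] by (intro exI[of _ 1]) (auto intro: poly_DERIV)
      qed
      thus "covered \<eta>' C' l (\<lambda>r' q' l'. \<exists>p'. degree p' \<le> E \<and>
        (\<forall>i<l'. of_int \<lfloor>f (poly p (real (r + q * r' + q * q' * i)))\<rfloor> = poly p' (real i)))"
      proof (rule covered_mono)
        fix r' q' l'
        assume "\<exists>p. degree p \<le> E \<and> (\<forall>i<l'. of_int \<lfloor>poly ((pderiv ^^ 0) p1) (real (r' + q' * i))\<rfloor> = poly p (real i))"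
        then obtain p2 where p2: "degree p2 \<le> E"
          "\<And>i. i < l' \<Longrightarrow> of_int \<lfloor>poly p1 (real (r' + q' * i))\<rfloor> = poly p2 (real i)" by auto
        assume sub: "\<forall>i<l'. r' + q' * i < l"
        have "of_int \<lfloor>f (poly p (real (r + q * r' + q * q' * i)))\<rfloor> = poly p2 (real i)" if i: "i < l'" for i
        proof -
          have "r + q * r' + q * q' * i = r + q * (r' + q' * i)" by (simp add: algebra_simps)
          moreover have "r' + q' * i < l" using sub i by blast
          ultimately show ?thesis by (simp only: p1(2) p2(2)[OF i])
        qed
        thus "\<exists>p'. degree p' \<le> E \<and>
          (\<forall>i<l'. of_int \<lfloor>f (poly p (real (r + q * r' + q * q' * i)))\<rfloor> = poly p' (real i))"
          using p2(1) by blast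
      qed
    qed
  qed (use F(1-3) G(1-3) in \<open>auto simp: mult_le_one refined_const_ge_1\<close>)
qed

lemma gp_pw_poly_on: "gp g \<Longrightarrow> pw_poly_on g D"
proof (induction rule: gp.induct)
  case (gp_poly P)
  show ?case
  proof (rule pw_poly_onI[where \<eta> = 1 and C = 1 and E = "degree P * D"])
    fix p :: "real poly" and H :: nat assume p: "degree p \<le> D" and H: "1 \<le> H"
    have "degree (pcompose P p) \<le> degree P * D" using p by (simp add: degree_pcompose)
    thus "covered 1 1 H (\<lambda>r q l. \<exists>p'. degree p' \<le> degree P * D \<and>
       (\<forall>i<l. poly P (poly p (real (r + q * i))) = poly p' (real i)))"
      by (intro covered_trivial[OF H] exI[of _ "pcompose P p"]) (simp add: poly_pcompose)
  qed auto
next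
  case (gp_add f g)
  show ?case
    by (rule pw_poly_on_binop[where P = "(+)" and F = "(+)", OF gp_add.IH]) (simp_all add: degree_add_le)
next
  case (gp_mult f g)
  show ?case
    by (rule pw_poly_on_binop[where P = "(*)" and F = "(*)", OF gp_mult.IH]) (simp_all add: degree_mult_le)
next
  case (gp_floor f)
  show ?case by (rule pw_poly_on_floor[OF gp_floor.IH])
qed

lemma gp_floor_tame_covered:
  assumes g: "gp g"
  shows "\<exists>\<eta> C E. 0 < \<eta> \<and> \<eta> \<le> 1 \<and> 1 \<le> C \<and> (\<forall>G H. 1 \<le> H \<longrightarrow> tame d H G \<longrightarrow>
    covered \<eta> C H (\<lambda>r q l. \<exists>p. degree p \<le> E \<and>
       (\<forall>i<l. g (of_int \<lfloor>G 0 (real (r + q * i))\<rfloor>) = poly p (real i))))"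
proof -
  obtain \<eta> C where F: "0 < \<eta>" "\<eta> \<le> 1" "1 \<le> C" "\<And>G H. 1 \<le> H \<Longrightarrow> tame d H G \<Longrightarrow>
     covered \<eta> C H (\<lambda>r q l. \<exists>p. degree p \<le> d \<and>
       (\<forall>i<l. of_int \<lfloor>G 0 (real (r + q * i))\<rfloor> = poly p (real i)))"
    using floor_tame_covered[of d] by blast
  obtain \<eta>' C' E where G: "0 < \<eta>'" "\<eta>' \<le> 1" "1 \<le> C'" "\<And>p H. degree p \<le> d \<Longrightarrow> 1 \<le> H \<Longrightarrow>
     covered \<eta>' C' H (\<lambda>r q l. \<exists>p'. degree p' \<le> E \<and> (\<forall>i<l. g (poly p (real (r + q * i))) = poly p' (real i)))"
    using gp_pw_poly_on[OF g, of d] unfolding pw_poly_on_def by blast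
  show ?thesis
  proof (rule exI[of _ "\<eta> * \<eta>'"], rule exI[of _ "C\<^sup>2 * C'"], rule exI[of _ E], intro conjI allI impI)
    show "0 < \<eta> * \<eta>'" "\<eta> * \<eta>' \<le> 1" "1 \<le> C\<^sup>2 * C'"
      using F(1-3) G(1-3) by (auto simp: mult_le_one refined_const_ge_1)
    fix u :: "nat \<Rightarrow> real \<Rightarrow> real" and H :: nat
    assume H: "1 \<le> H" and u: "tame d H u"
    show "covered (\<eta> * \<eta>') (C\<^sup>2 * C') H (\<lambda>r q l. \<exists>p. degree p \<le> E \<and>
       (\<forall>i<l. g (of_int \<lfloor>u 0 (real (r + q * i))\<rfloor>) = poly p (real i)))"
    proof (rule covered_refine[OF F(4)[OF H u] F(3) G(3) H less_imp_le[OF G(1)] G(2)])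
      fix r q l
      assume "\<exists>p. degree p \<le> d \<and> (\<forall>i<l. of_int \<lfloor>u 0 (real (r + q * i))\<rfloor> = poly p (real i))" and l: "1 \<le> l"
      then obtain p1 where p1: "degree p1 \<le> d" "\<And>i. i < l \<Longrightarrow> of_int \<lfloor>u 0 (real (r + q * i))\<rfloor> = poly p1 (real i)"
        by blast
      show "covered \<eta>' C' l (\<lambda>r' q' l'. \<exists>p. degree p \<le> E \<and>
        (\<forall>i<l'. g (of_int \<lfloor>u 0 (real (r + q * r' + q * q' * i))\<rfloor>) = poly p (real i)))"
      proof (rule covered_mono[OF G(4)[OF p1(1) l]])
        fix r' q' l'
        assume "\<exists>p. degree p \<le> E \<and> (\<forall>i<l'. g (poly p1 (real (r' + q' * i))) = poly p (real i))"
        then obtain p2 where p2: "degree p2 \<le> E"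
          "\<And>i. i < l' \<Longrightarrow> g (poly p1 (real (r' + q' * i))) = poly p2 (real i)" by blast
        assume sub: "\<forall>i<l'. r' + q' * i < l"
        have "g (of_int \<lfloor>u 0 (real (r + q * r' + q * q' * i))\<rfloor>) = poly p2 (real i)" if i: "i < l'" for i
        proof -
          have "r + q * r' + q * q' * i = r + q * (r' + q' * i)" by (simp add: algebra_simps)
          moreover have "r' + q' * i < l" using sub i by blast
          ultimately show ?thesis by (simp only: p1(2) p2(2)[OF i])
        qed
        thus "\<exists>p. degree p \<le> E \<and>
          (\<forall>i<l'. g (of_int \<lfloor>u 0 (real (r + q * r' + q * q' * i))\<rfloor>) = poly p (real i))"
          using p2(1) by blast
      qed
    qed
  qed
qed

section \<open>From bounded degree to constant pieces\<close>

lemma poly_finite_values_const: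
  fixes p :: "real poly"
  assumes V: "finite V" and p: "degree p \<le> E" and l: "card V * E < l"
    and vals: "\<And>i. i < l \<Longrightarrow> poly p (real i) \<in> V"
  shows "\<exists>v. \<forall>i<l. poly p (real i) = v"
proof (cases "\<exists>v. p = [:v:]")
  case False
  define A where "A = (\<lambda>v. {i. i < l \<and> poly p (real i) = v})"
  have "card (A v) \<le> E" for v
  proof -
    have ne: "p - [:v:] \<noteq> 0" using False by auto
    have "inj_on real (A v)" by (auto simp: inj_on_def)
    hence "card (A v) = card (real ` A v)" by (simp add: card_image)
    also have "\<dots> \<le> card {x. poly (p - [:v:]) x = 0}"
      by (intro card_mono poly_roots_finite ne) (auto simp: A_def)
    also have "\<dots> \<le> degree (p - [:v:])" by (rule card_poly_roots_bound[OF ne])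
    also have "\<dots> \<le> E" using p by (intro degree_diff_le) auto
    finally show ?thesis .
  qed
  have "{..<l} = (\<Union>v\<in>V. A v)" using vals by (auto simp: A_def)
  hence "l \<le> (\<Sum>v\<in>V. card (A v))" using card_UN_le[OF V, of A] by (metis card_lessThan)
  also have "\<dots> \<le> (\<Sum>v\<in>V. E)" by (intro sum_mono \<open>\<And>v. card (A v) \<le> E\<close>)
  finally show ?thesis using l by simp
qed auto

lemma covered_singletons:
  assumes "real l \<le> C"
  shows "covered 1 C l (\<lambda>r q l'. l' = 1)"
proof -
  define S where "S = (\<lambda>i. (i, 1::nat, 1::nat)) ` {..<l}"
  have "card S \<le> l" unfolding S_def using card_image_le[of "{..<l}"] by simp
  hence "real (card S) \<le> C * real l powr (1 - 1)" using assms by (cases "l = 0") (auto simp: S_def)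
  moreover have "1 \<le> C * real l powr 1" if "i < l" for i
  proof -
    have "1 \<le> real l" using that by simp
    hence "1 * 1 \<le> C * real l" using assms by (intro mult_mono) auto
    thus ?thesis by simp
  qed
  ultimately show ?thesis unfolding covered_def by (intro exI[of _ S]) (auto simp: S_def)
qed

lemma finite_gp_floor_tame_covered:
  assumes g: "gp g" and fin: "finite (range (\<lambda>n::int. g (of_int n)))"
  shows "\<exists>\<eta> C. 0 < \<eta> \<and> \<eta> \<le> 1 \<and> 1 \<le> C \<and> (\<forall>G H. 1 \<le> H \<longrightarrow> tame d H G \<longrightarrow>
    covered \<eta> C H (\<lambda>r q l. \<exists>v. \<forall>i<l. g (of_int \<lfloor>G 0 (real (r + q * i))\<rfloor>) = v))"
proof -
  obtain \<eta> C E where F: "0 < \<eta>" "\<eta> \<le> 1" "1 \<le> C"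
    "\<And>G H. 1 \<le> H \<Longrightarrow> tame d H G \<Longrightarrow> covered \<eta> C H (\<lambda>r q l. \<exists>p. degree p \<le> E \<and>
       (\<forall>i<l. g (of_int \<lfloor>G 0 (real (r + q * i))\<rfloor>) = poly p (real i)))"
    using gp_floor_tame_covered[OF g, of d] by blast
  define V where "V = range (\<lambda>n::int. g (of_int n))"
  \<comment> \<open>The threshold below which the polynomial may fail to be constant. Progressions
    that short are split into single points, boundedly many each.\<close>
  define B where "B = real (card V * E) + 1"
  have B: "1 \<le> B" by (simp add: B_def)
  show ?thesis
  proof (rule exI[of _ "\<eta> * 1"], rule exI[of _ "C\<^sup>2 * B"], intro conjI allI impI)
    show "0 < \<eta> * 1" "\<eta> * 1 \<le> 1" "1 \<le> C\<^sup>2 * B" using F(1-3) B by (auto simp: refined_const_ge_1)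
    fix G :: "nat \<Rightarrow> real \<Rightarrow> real" and H :: nat
    assume H: "1 \<le> H" and G: "tame d H G"
    show "covered (\<eta> * 1) (C\<^sup>2 * B) H (\<lambda>r q l. \<exists>v. \<forall>i<l. g (of_int \<lfloor>G 0 (real (r + q * i))\<rfloor>) = v)"
    proof (rule covered_refine[OF F(4)[OF H G] F(3) B H])
      fix r q l
      assume "\<exists>p. degree p \<le> E \<and> (\<forall>i<l. g (of_int \<lfloor>G 0 (real (r + q * i))\<rfloor>) = poly p (real i))" and l: "1 \<le> l"
      then obtain p where p: "degree p \<le> E" "\<And>i. i < l \<Longrightarrow> g (of_int \<lfloor>G 0 (real (r + q * i))\<rfloor>) = poly p (real i)"
        by blast
      show "covered 1 B l (\<lambda>r' q' l'. \<exists>v. \<forall>i<l'. g (of_int \<lfloor>G 0 (real (r + q * r' + q * q' * i))\<rfloor>) = v)"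
      proof (cases "card V * E < l")
        case True
        have "\<exists>v. \<forall>i<l. poly p (real i) = v"
        proof (rule poly_finite_values_const[OF _ p(1) True])
          show "finite V" using fin by (simp add: V_def)
          show "poly p (real i) \<in> V" if "i < l" for i using p(2)[OF that, symmetric] by (simp add: V_def)
        qed
        then obtain v where "\<forall>i<l. poly p (real i) = v" by blast
        hence "\<forall>i<l. g (of_int \<lfloor>G 0 (real (r + q * 0 + q * 1 * i))\<rfloor>) = v" using p(2) by simp
        hence "covered 1 1 l (\<lambda>r' q' l'. \<exists>v. \<forall>i<l'. g (of_int \<lfloor>G 0 (real (r + q * r' + q * q' * i))\<rfloor>) = v)"
          by (intro covered_trivial[OF l] exI[of _ v])
        thus ?thesis by (rule covered_mono_const) (rule B)
      next
        case False
        hence "l \<le> card V * E" by simp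
        hence "real l \<le> real (card V * E)" by (rule of_nat_mono)
        hence "covered 1 B l (\<lambda>r q l'. l' = 1)" by (intro covered_singletons) (simp add: B_def)
        thus ?thesis by (rule covered_mono) simp
      qed
    qed auto
  qed
qed

section \<open>Counting words\<close>

text \<open>A word is recovered from a list of at most m quadruples: start, step, length and the
  letter on that progression. Counting such lists gives the bound.\<close>

lemma card_words_covered:
  fixes W :: "(nat \<Rightarrow> 'a::finite) set"
  assumes H: "1 \<le> H" and C: "0 \<le> C"
    and cov: "\<And>b. b \<in> W \<Longrightarrow> covered \<eta> C H (\<lambda>r q l. \<exists>v. \<forall>i<l. b (r + q * i) = v)"
  shows "real (card ((\<lambda>b. map b [0..<H]) ` W)) \<le>
    (4 * real (card (UNIV :: 'a set)) * real H ^ 3) powr (C * real H powr (1 - \<eta>))"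
proof -
  define U where "U = {..<H} \<times> {..H} \<times> {..H} \<times> (UNIV :: 'a set)"
  define m where "m = nat \<lfloor>C * real H powr (1 - \<eta>)\<rfloor>"
  define hit where "hit = (\<lambda>h (r, q, l, v :: 'a). \<exists>i<l. h = r + q * (i :: nat))"
  define val where "val = (\<lambda>(r :: nat, q :: nat, l :: nat, v :: 'a). v)"
  \<comment> \<open>Which of the progressions through h is chosen is irrelevant: all of them carry
    the letter at h.\<close>
  define dec where "dec = (\<lambda>xs h. val (SOME x. x \<in> set xs \<and> hit h x))"
  define L where "L = {xs. set xs \<subseteq> U \<and> length xs = m}"
  have finU: "finite U" by (simp add: U_def)
  have finL: "finite L" unfolding L_def by (rule finite_lists_length_eq[OF finU])
  have "(\<lambda>b. map b [0..<H]) ` W \<subseteq> (\<lambda>xs. map (dec xs) [0..<H]) ` L"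
  proof
    fix w assume "w \<in> (\<lambda>b. map b [0..<H]) ` W"
    then obtain b where b: "b \<in> W" "w = map b [0..<H]" by blast
    obtain S where S: "finite S" "real (card S) \<le> C * real H powr (1 - \<eta>)"
      "\<forall>(r, q, l)\<in>S. real l \<le> C * real H powr \<eta> \<and> (\<forall>i<l. r + q * i < H) \<and> (\<exists>v. \<forall>i<l. b (r + q * i) = v)"
      "\<forall>h<H. \<exists>(r, q, l)\<in>S. \<exists>i<l. h = r + q * i"
      using cov[OF b(1)] unfolding covered_def by blast
    \<comment> \<open>The step of a one-term progression is arbitrary, and so is the length of one
      with step 0. Both kinds are normalised to a single point, after which step and length are at
      most H.\<close>
    define code where "code = (\<lambda>(r :: nat, q :: nat, l :: nat). if l \<le> 1 \<or> q = 0 then (r, 0, 1, b r) else (r, q, l, b r))"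
    define S1 where "S1 = {s\<in>S. 1 \<le> snd (snd s)}"
    have S1: "finite S1" "card S1 \<le> card S" using S(1) by (auto simp: S1_def intro: card_mono)
    have range: "code s \<in> U" if s: "s \<in> S1" for s
    proof -
      obtain r q l where rql: "s = (r, q, l)" by (cases s) auto
      have mem: "(r, q, l) \<in> S" and l1: "1 \<le> l" using s by (auto simp: S1_def rql)
      have sub: "r + q * i < H" if "i < l" for i using S(3) mem that by fast
      have r: "r < H" using sub[of 0] l1 by simp
      show ?thesis
      proof (cases "l \<le> 1 \<or> q = 0")
        case True
        thus ?thesis using r H by (auto simp: code_def rql U_def)
      next
        case False
        have q: "q \<le> H" using sub[of 1] False by simp
        have "l - 1 \<le> q * (l - 1)" using False by simp
        moreover have "r + q * (l - 1) < H" using l1 by (intro sub) simp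
        ultimately have "l - 1 < H" by linarith
        thus ?thesis using r q False by (auto simp: code_def rql U_def)
      qed
    qed
    have sound: "b h = val x" if x: "x \<in> code ` S1" and "hit h x" for x h
    proof -
      obtain r q l where rql: "(r, q, l) \<in> S1" "x = code (r, q, l)" using x by auto
      have l1: "1 \<le> l" and mem: "(r, q, l) \<in> S" using rql by (auto simp: S1_def)
      obtain v where v: "\<And>i. i < l \<Longrightarrow> b (r + q * i) = v" using S(3) mem by fast
      have "b r = v" using v[of 0] l1 by simp
      thus ?thesis using \<open>hit h x\<close> v by (auto simp: rql(2) code_def hit_def val_def split: if_splits)
    qed
    have complete: "\<exists>x\<in>code ` S1. hit h x" if h: "h < H" for h
    proof -
      obtain r q l i where x: "(r, q, l) \<in> S" "i < l" "h = r + q * i" using S(4) h by fast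
      hence "(r, q, l) \<in> S1" by (auto simp: S1_def)
      moreover have "hit h (code (r, q, l))" using x by (auto simp: hit_def code_def)
      ultimately show ?thesis by blast
    qed
    obtain xs0 where xs0: "set xs0 = code ` S1" "distinct xs0"
      using finite_distinct_list[of "code ` S1"] S1(1) by auto
    have ne: "xs0 \<noteq> []" using complete[of 0] H xs0(1) by auto
    have "length xs0 = card (code ` S1)" using xs0 distinct_card by metis
    also have "\<dots> \<le> card S" using card_image_le[OF S1(1), of code] S1(2) by linarith
    also have "\<dots> \<le> m" unfolding m_def using S(2) by (rule le_nat_floor)
    finally have len: "length xs0 \<le> m" .
    \<comment> \<open>Repeating an entry pads the list to length exactly m without changing its
      set.\<close>
    define xs where "xs = xs0 @ replicate (m - length xs0) (hd xs0)"
    have set: "set xs = code ` S1" using ne xs0(1) by (auto simp: xs_def)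
    have "length xs = m" using len by (simp add: xs_def)
    hence "xs \<in> L" using set range by (auto simp: L_def)
    moreover have "b h = dec xs h" if "h < H" for h
    proof -
      have "\<exists>x. x \<in> set xs \<and> hit h x" using complete[OF that] unfolding set by blast
      hence "(SOME x. x \<in> set xs \<and> hit h x) \<in> set xs \<and> hit h (SOME x. x \<in> set xs \<and> hit h x)" by (rule someI_ex)
      thus ?thesis unfolding dec_def using sound unfolding set by blast
    qed
    hence "w = map (dec xs) [0..<H]" unfolding b(2) by (intro map_cong) auto
    ultimately show "w \<in> (\<lambda>xs. map (dec xs) [0..<H]) ` L" by blast
  qed
  hence "card ((\<lambda>b. map b [0..<H]) ` W) \<le> card ((\<lambda>xs. map (dec xs) [0..<H]) ` L)"
    using finL by (intro card_mono) auto
  also have "\<dots> \<le> card L" by (rule card_image_le[OF finL])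
  also have "card L = card U ^ m" unfolding L_def by (rule card_lists_length_eq[OF finU])
  finally have "real (card ((\<lambda>b. map b [0..<H]) ` W)) \<le> real (card U ^ m)" by (rule of_nat_mono)
  also have "\<dots> = real (card U) ^ m" by simp
  also have "\<dots> \<le> (4 * real (card (UNIV :: 'a set)) * real H ^ 3) ^ m"
  proof (intro power_mono)
    have "real (card U) = real H * (real H + 1) * (real H + 1) * real (card (UNIV :: 'a set))"
      by (simp add: U_def card_cartesian_product algebra_simps)
    also have "\<dots> \<le> real H * (2 * real H) * (2 * real H) * real (card (UNIV :: 'a set))"
      using H by (intro mult_mono) auto
    finally show "real (card U) \<le> 4 * real (card (UNIV :: 'a set)) * real H ^ 3" by (simp add: power3_eq_cube mult_ac)
  qed auto
  also have "\<dots> \<le> (4 * real (card (UNIV :: 'a set)) * real H ^ 3) powr (C * real H powr (1 - \<eta>))"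
  proof -
    have "1 \<le> card (UNIV :: 'a set)" by (simp add: Suc_le_eq card_gt_0_iff)
    hence "1 * 1 \<le> (4 * real (card (UNIV :: 'a set))) * real H ^ 3" using H by (intro mult_mono one_le_power) auto
    moreover have "real m \<le> C * real H powr (1 - \<eta>)" unfolding m_def using C by simp
    ultimately show ?thesis by (subst powr_realpow[symmetric]) (auto intro!: powr_mono)
  qed
  finally show ?thesis .
qed

lemma card_words_covered_exp:
  fixes W :: "nat \<Rightarrow> (nat \<Rightarrow> 'a::finite) set"
  assumes \<eta>: "0 < \<eta>" and C: "1 \<le> C"
    and cov: "\<And>H b. 1 \<le> H \<Longrightarrow> b \<in> W H \<Longrightarrow> covered \<eta> C H (\<lambda>r q l. \<exists>v. \<forall>i<l. b (r + q * i) = v)"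
  shows "\<exists>B\<ge>0. \<forall>H\<ge>1. real (card ((\<lambda>b. map b [0..<H]) ` W H)) \<le> exp (B * real H powr (1 - \<eta> / 2))"
proof -
  \<comment> \<open>The logarithm of H is at most (2 / \<eta>) H^(\<eta>/2), and the alphabet of
    quadruples is cubic in H: hence 6 / \<eta>, and the loss of half of \<eta> in the
    exponent.\<close>
  define K where "K = ln (4 * real (card (UNIV :: 'a set))) + 6 / \<eta>"
  have A: "1 \<le> real (card (UNIV :: 'a set))" by (simp add: Suc_le_eq card_gt_0_iff)
  have K: "0 \<le> K" using \<eta> A by (simp add: K_def)
  have "real (card ((\<lambda>b. map b [0..<H]) ` W H)) \<le> exp (C * K * real H powr (1 - \<eta> / 2))"
    if H: "1 \<le> H" for H
  proof -
  define x where "x = 4 * real (card (UNIV :: 'a set)) * real H ^ 3"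
  have "0 < x" using A H by (simp add: x_def)
  have "ln x = ln (4 * real (card (UNIV :: 'a set))) + 3 * ln (real H)"
    using A H by (simp add: x_def ln_mult ln_realpow)
  also have "ln (real H) \<le> real H powr (\<eta> / 2) / (\<eta> / 2)"
    using H \<eta> by (intro ln_powr_bound) auto
  also have "ln (4 * real (card (UNIV :: 'a set))) \<le> ln (4 * real (card (UNIV :: 'a set))) * real H powr (\<eta> / 2)"
    using A H \<eta> by (intro mult_right_le_one_le[THEN ord_le_eq_trans] | simp add: mult_le_cancel_left1 ge_one_powr_ge_zero)+
  finally have lnx: "ln x \<le> K * real H powr (\<eta> / 2)" by (simp add: K_def field_simps)
  have "real (card ((\<lambda>b. map b [0..<H]) ` W H)) \<le> x powr (C * real H powr (1 - \<eta>))"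
    unfolding x_def using C by (intro card_words_covered[OF H] cov H) auto
  also have "\<dots> = exp (C * real H powr (1 - \<eta>) * ln x)" using \<open>0 < x\<close> by (simp add: powr_def)
  also have "C * real H powr (1 - \<eta>) * ln x \<le> C * real H powr (1 - \<eta>) * (K * real H powr (\<eta> / 2))"
    using C by (intro mult_left_mono lnx) auto
  also have "\<dots> = C * K * (real H powr (1 - \<eta>) * real H powr (\<eta> / 2))" by (simp add: mult_ac)
  also have "real H powr (1 - \<eta>) * real H powr (\<eta> / 2) = real H powr (1 - \<eta> / 2)"
    by (simp flip: powr_add)
  finally show ?thesis by simp
  qed
  thus ?thesis using K C by (intro exI[of _ "C * K"]) auto
qed

section \<open>Hardy field functions of polynomial growth\<close>

text \<open>Closure under differentiation only gives some representative of the derivative, valid on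
  some half-line. Successive derivatives are therefore picked by dependent choice.\<close>

lemma hardy_field_tower:
  assumes F: "hardy_field F" and g: "g \<in> F"
  obtains D where "D 0 = g" "\<And>j. D j \<in> F"
    "\<And>j. \<forall>\<^sub>F x in at_top. (D j has_real_derivative D (Suc j) x) (at x)"
proof -
  have ex: "\<forall>f\<in>F. \<exists>h\<in>F. \<forall>\<^sub>F x in at_top. (f has_real_derivative h x) (at x)"
    using F unfolding hardy_field_def by (elim conjE)
  have "\<exists>D. \<forall>n. (D n \<in> F \<and> (n = 0 \<longrightarrow> D n = g)) \<and>
      (\<forall>\<^sub>F x in at_top. (D n has_real_derivative D (Suc n) x) (at x))"
    by (rule dependent_nat_choice) (use g ex in auto)
  thus ?thesis using that by metis
qed

text \<open>A nonzero germ has a reciprocal and so has no zeros far out; being differentiable it is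
  continuous there, and the intermediate value theorem fixes its sign.\<close>

lemma hardy_field_eventually_sign:
  assumes F: "hardy_field F" and g: "g \<in> F"
    and diff: "\<forall>\<^sub>F x in at_top. (g has_real_derivative g' x) (at x)"
  obtains c :: real where "c \<noteq> 0" "\<forall>\<^sub>F x in at_top. 0 \<le> c * g x"
proof (cases "\<forall>\<^sub>F x in at_top. g x = 0")
  case True
  hence "\<forall>\<^sub>F x in at_top. 0 \<le> 1 * g x" by eventually_elim simp
  thus ?thesis using that[of 1] by simp
next
  case False
  have "\<forall>f\<in>F. \<not> (\<forall>\<^sub>F x in at_top. f x = 0) \<longrightarrow> (\<exists>h\<in>F. \<forall>\<^sub>F x in at_top. f x * h x = 1)"
    using F unfolding hardy_field_def by (elim conjE)
  then obtain h where "\<forall>\<^sub>F x in at_top. g x * h x = 1" using g False by blast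
  with diff have "\<forall>\<^sub>F x in at_top. (g has_real_derivative g' x) (at x) \<and> g x \<noteq> 0"
    by eventually_elim auto
  then obtain T where T: "\<And>x. T \<le> x \<Longrightarrow> (g has_real_derivative g' x) (at x)" "\<And>x. T \<le> x \<Longrightarrow> g x \<noteq> 0"
    unfolding eventually_at_top_linorder by blast
  define c where "c = sgn (g T)"
  have c: "c \<noteq> 0" "0 < c * g T" using T(2)[of T] by (auto simp: c_def sgn_if)
  have "0 \<le> c * g x" if x: "T \<le> x" for x
  proof (rule ccontr)
    assume "\<not> 0 \<le> c * g x"
    moreover have "continuous_on {T..x} (\<lambda>x. c * g x)"
      by (intro continuous_at_imp_continuous_on ballI continuous_intros)
        (use T(1) DERIV_isCont in auto)
    ultimately obtain y where "T \<le> y" "c * g y = 0" using IVT2'[of "\<lambda>x. c * g x" x 0 T] c x by auto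
    thus False using c(1) T(2) by auto
  qed
  hence "\<forall>\<^sub>F x in at_top. 0 \<le> c * g x" using eventually_at_top_linorder by blast
  thus ?thesis using that c(1) by blast
qed

text \<open>A monotone derivative at \<open>t\<close> lies between two of its mean values, over \<open>[t/2, t]\<close> and
  \<open>[t, 2t]\<close>.\<close>
lemma growth_derivative:
  assumes u: "\<forall>\<^sub>F t in at_top. (u has_real_derivative v t) (at t)"
    and v: "\<forall>\<^sub>F t in at_top. (v has_real_derivative w t) (at t)"
    and c: "c \<noteq> 0" "\<forall>\<^sub>F t in at_top. 0 \<le> c * w t"
    and bound: "\<forall>\<^sub>F t in at_top. \<bar>u t\<bar> \<le> C * t powr m"
  shows "\<exists>C'. \<forall>\<^sub>F t in at_top. \<bar>v t\<bar> \<le> C' * t powr (m - 1)"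
proof -
  have "\<forall>\<^sub>F t in at_top. (u has_real_derivative v t) (at t) \<and> (v has_real_derivative w t) (at t) \<and>
      0 \<le> c * w t \<and> \<bar>u t\<bar> \<le> C * t powr m \<and> 1 \<le> t"
    using u v c(2) bound eventually_ge_at_top[of 1] by eventually_elim auto
  then obtain T where T: "\<And>t. T \<le> t \<Longrightarrow> (u has_real_derivative v t) (at t)"
    "\<And>t. T \<le> t \<Longrightarrow> (v has_real_derivative w t) (at t)" "\<And>t. T \<le> t \<Longrightarrow> 0 \<le> c * w t"
    "\<And>t. T \<le> t \<Longrightarrow> \<bar>u t\<bar> \<le> C * t powr m" "\<And>t. T \<le> t \<Longrightarrow> 1 \<le> t"
    unfolding eventually_at_top_linorder by blast
  have T1: "1 \<le> T" using T(5) by simp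
  have mono: "c * v x \<le> c * v y" if "T \<le> x" "x \<le> y" for x y
  proof (rule DERIV_nonneg_imp_nondecreasing[OF that(2)])
    fix z assume "x \<le> z" "z \<le> y"
    thus "\<exists>y. ((\<lambda>x. c * v x) has_real_derivative y) (at z) \<and> 0 \<le> y"
      using that T(2,3)[of z] by (intro exI[of _ "c * w z"]) (auto intro!: DERIV_cmult)
  qed
  \<comment> \<open>The summands bound u at t, 2 t and t / 2; the factor 2 is due to the interval
    [t/2, t], whose length is t / 2 only.\<close>
  define C' where "C' = 2 * C * (1 + 2 powr m + (1/2) powr m)"
  have C0: "0 \<le> C"
  proof -
    have "0 \<le> C * T powr m" using T(4)[of T] by linarith
    thus ?thesis using T1 by (simp add: zero_le_mult_iff)
  qed
  have "\<bar>v t\<bar> \<le> C' * t powr (m - 1)" if t: "2 * T \<le> t" for t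
  proof -
    have t0: "0 < t" "T \<le> t" "T \<le> t / 2" "T \<le> 2 * t" using t T1 by auto
    have tm: "t powr m / t = t powr (m - 1)" using t0 by (simp add: powr_diff)
    have up: "\<bar>u (s * t)\<bar> \<le> C * (s powr m * t powr m)" if "T \<le> s * t" "0 < s" for s
      using T(4)[OF that(1)] that t0 by (simp add: powr_mult)
    have u1: "\<bar>u (2 * t)\<bar> \<le> C * (2 powr m * t powr m)" using up[of 2] t0 by simp
    have u2: "\<bar>u (t / 2)\<bar> \<le> C * ((1/2) powr m * t powr m)" using up[of "1/2"] t0 by simp
    have u0: "\<bar>u t\<bar> \<le> C * t powr m" using T(4) t0 by simp
    have nn: "0 \<le> C * (2 powr m * t powr m)" "0 \<le> C * ((1/2) powr m * t powr m)" "0 \<le> C * t powr m"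
      using C0 by auto
    have C't: "C' * t powr (m - 1) * t = 2 * (C * t powr m + C * (2 powr m * t powr m) + C * ((1/2) powr m * t powr m))"
      using t0 by (simp add: C'_def algebra_simps flip: tm)
    have "\<exists>z. t < z \<and> z < 2 * t \<and> u (2 * t) - u t = (2 * t - t) * v z"
      using t0 by (intro MVT2) (auto intro!: T(1))
    then obtain z where z: "t < z" "u (2 * t) - u t = t * v z" by auto
    have "\<exists>z. t / 2 < z \<and> z < t \<and> u t - u (t / 2) = (t - t / 2) * v z"
      using t0 by (intro MVT2) (auto intro!: T(1))
    then obtain y where y: "t / 2 < y" "y < t" "u t - u (t / 2) = t / 2 * v y" by auto
    have "t * \<bar>v z\<bar> \<le> C' * t powr (m - 1) * t"
      using z(2) u0 u1 nn t0 unfolding C't by (simp add: abs_if split: if_splits)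
    hence vz: "\<bar>v z\<bar> \<le> C' * t powr (m - 1)" using t0 by (simp add: mult.commute)
    have "t * \<bar>v y\<bar> \<le> C' * t powr (m - 1) * t"
      using y(3) u0 u2 nn t0 unfolding C't by (simp add: abs_if split: if_splits)
    hence vy: "\<bar>v y\<bar> \<le> C' * t powr (m - 1)" using t0 by (simp add: mult.commute)
    have "c * v y \<le> c * v t" "c * v t \<le> c * v z" using mono[of y t] mono[of t z] y z t0 by auto
    hence "(v y \<le> v t \<and> v t \<le> v z) \<or> (v z \<le> v t \<and> v t \<le> v y)"
      using c(1) by (cases "0 < c") (auto simp: mult_le_cancel_left)
    thus ?thesis using vz vy by linarith
  qed
  thus ?thesis unfolding eventually_at_top_linorder by blast
qed

text \<open>Each differentiation lowers the growth exponent by one, so the derivative of order n + 1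
  is O(1/t). One threshold T then serves the finitely many eventual statements.\<close>

lemma hardy_poly_growth_tower:
  assumes f: "hardy_field_function f" and growth: "polynomial_growth f"
  obtains n D c B T where "c \<noteq> 0" "1 \<le> B" "1 \<le> T" "\<And>t. T \<le> t \<Longrightarrow> f t = D 0 t"
    "\<And>j t. j \<le> n \<Longrightarrow> T \<le> t \<Longrightarrow> (D j has_real_derivative D (Suc j) t) (at t)"
    "\<And>t. T \<le> t \<Longrightarrow> 0 \<le> c * D (Suc n) t" "\<And>t. T \<le> t \<Longrightarrow> \<bar>D (Suc n) t\<bar> * t \<le> B"
proof -
  obtain F g where F: "hardy_field F" "g \<in> F" "\<forall>\<^sub>F x in at_top. f x = g x"
    using f unfolding hardy_field_function_def by blast
  obtain D where D: "D 0 = g" "\<And>j. D j \<in> F"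
    "\<And>j. \<forall>\<^sub>F x in at_top. (D j has_real_derivative D (Suc j) x) (at x)"
    using hardy_field_tower[OF F(1,2)] by blast
  obtain n where "((\<lambda>t. f t / t ^ n) \<longlongrightarrow> 0) at_top" using growth unfolding polynomial_growth_def by blast
  hence "\<forall>\<^sub>F t in at_top. dist (f t / t ^ n) 0 < 1" by (rule tendstoD) simp
  hence f_bound: "\<forall>\<^sub>F t in at_top. \<bar>D 0 t\<bar> \<le> 1 * t powr (real n - real 0)"
    using F(3) eventually_gt_at_top[of 0]
    by eventually_elim (simp add: D(1) powr_realpow abs_divide divide_less_eq less_imp_le)
  have bound: "\<exists>C. \<forall>\<^sub>F t in at_top. \<bar>D j t\<bar> \<le> C * t powr (real n - real j)" for j
  proof (induction j)
    case 0
    show ?case using f_bound by blast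
  next
    case (Suc j)
    then obtain C where C: "\<forall>\<^sub>F t in at_top. \<bar>D j t\<bar> \<le> C * t powr (real n - real j)" by blast
    \<comment> \<open>To bound \<open>D (Suc j)\<close> through \<open>D j\<close>, the former must
      be monotone, which is a sign condition on the derivative after it.\<close>
    obtain c where "c \<noteq> 0" "\<forall>\<^sub>F x in at_top. 0 \<le> c * D (Suc (Suc j)) x"
      by (rule hardy_field_eventually_sign[OF F(1) D(2) D(3)])
    from growth_derivative[OF D(3) D(3) this C] show ?case by (simp add: diff_diff_eq add.commute)
  qed
  obtain C where C: "\<forall>\<^sub>F t in at_top. \<bar>D (Suc n) t\<bar> \<le> C * t powr (real n - real (Suc n))"
    using bound by blast
  obtain c where c: "c \<noteq> 0" "\<forall>\<^sub>F x in at_top. 0 \<le> c * D (Suc n) x"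
    by (rule hardy_field_eventually_sign[OF F(1) D(2) D(3)])
  define B where "B = max 1 C"
  have 1: "\<forall>\<^sub>F t in at_top. \<bar>D (Suc n) t\<bar> * t \<le> B"
    using C eventually_gt_at_top[of 0]
    by eventually_elim (auto simp: B_def powr_minus field_simps)
  have 2: "\<forall>\<^sub>F t in at_top. \<forall>j\<in>{..n}. (D j has_real_derivative D (Suc j) t) (at t)"
    by (intro eventually_ball_finite) (use D(3) in auto)
  have "\<forall>\<^sub>F t in at_top. f t = D 0 t \<and> (\<forall>j\<in>{..n}. (D j has_real_derivative D (Suc j) t) (at t)) \<and>
      0 \<le> c * D (Suc n) t \<and> \<bar>D (Suc n) t\<bar> * t \<le> B \<and> 1 \<le> t"
    using 1 2 c(2) F(3) eventually_ge_at_top[of 1] by eventually_elim (simp add: D(1))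
  then obtain T where T: "\<And>t. T \<le> t \<Longrightarrow> f t = D 0 t \<and> (\<forall>j\<in>{..n}. (D j has_real_derivative D (Suc j) t) (at t)) \<and>
      0 \<le> c * D (Suc n) t \<and> \<bar>D (Suc n) t\<bar> * t \<le> B \<and> 1 \<le> t"
    unfolding eventually_at_top_linorder by blast
  show ?thesis
    by (rule that[of c B T D n]) (use T c(1) in \<open>auto simp: B_def\<close>)
qed

lemma hardy_shift_tame:
  assumes f: "hardy_field_function f" "polynomial_growth f"
  shows "\<exists>n A. 1 \<le> A \<and> (\<forall>N H. 1 \<le> H \<longrightarrow> A * real H ^ Suc n \<le> real N \<longrightarrow>
      (\<exists>G. tame n H G \<and> (\<forall>t\<ge>0. f (real N + t) = G 0 t)))"
proof -
  obtain n D c B T where D: "c \<noteq> 0" "1 \<le> B" "1 \<le> T" "\<And>t. T \<le> t \<Longrightarrow> f t = D 0 t"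
    "\<And>j t. j \<le> n \<Longrightarrow> T \<le> t \<Longrightarrow> (D j has_real_derivative D (Suc j) t) (at t)"
    "\<And>t. T \<le> t \<Longrightarrow> 0 \<le> c * D (Suc n) t" "\<And>t. T \<le> t \<Longrightarrow> \<bar>D (Suc n) t\<bar> * t \<le> B"
    by (rule hardy_poly_growth_tower[OF f]) blast
  show ?thesis
  \<comment> \<open>All factors being at least 1, the lower bound on N yields both N \<ge> T and N
    \<ge> B H^(n+1). The second makes B / N at most H^(-(n+1)).\<close>
  proof (rule exI[of _ n], rule exI[of _ "B * T"], intro conjI allI impI)
    have "1 * 1 \<le> B * T" using D(2,3) by (intro mult_mono) auto
    thus "1 \<le> B * T" by simp
    fix N H :: nat assume H: "1 \<le> H" and N: "B * T * real H ^ Suc n \<le> real N"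
    have Hn: "1 \<le> real H ^ Suc n" using H by (intro one_le_power) simp
    have BN: "B * real H ^ Suc n \<le> real N"
    proof -
      have "B * 1 * real H ^ Suc n \<le> B * T * real H ^ Suc n"
        using D(2,3) by (intro mult_right_mono mult_left_mono) auto
      thus ?thesis using N by simp
    qed
    have TN: "T \<le> real N"
    proof -
      have "1 * T * 1 \<le> B * T * real H ^ Suc n" using D(2,3) Hn by (intro mult_mono) auto
      thus ?thesis using N by simp
    qed
    define G where "G = (\<lambda>j t. D j (real N + t))"
    have "tame n H G" unfolding tame_def
    proof (intro exI[of _ c] conjI allI impI D(1))
      fix j and t :: real assume "j \<le> n" "0 \<le> t"
      hence "(D j has_real_derivative D (Suc j) (t + real N)) (at (t + real N))"
        using TN by (intro D(5)) auto
      thus "(G j has_real_derivative G (Suc j) t) (at t)"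
        unfolding DERIV_shift by (simp add: G_def add.commute)
    next
      fix t :: real assume t: "0 \<le> t"
      hence Tt: "T \<le> real N + t" using TN by simp
      show "0 \<le> c * G (Suc n) t" unfolding G_def by (rule D(6)[OF Tt])
      define x where "x = real N + t"
      have x: "B * real H ^ Suc n \<le> x" using BN t by (simp add: x_def)
      have "\<bar>D (Suc n) x\<bar> * real H ^ Suc n * B \<le> \<bar>D (Suc n) x\<bar> * x"
        using mult_left_mono[OF x, of "\<bar>D (Suc n) x\<bar>"] by (simp add: mult_ac)
      also have "\<dots> \<le> B" using D(7)[OF Tt] by (simp add: x_def)
      finally have "\<bar>D (Suc n) x\<bar> * real H ^ Suc n * B \<le> 1 * B" by simp
      hence "\<bar>D (Suc n) x\<bar> * real H ^ Suc n \<le> 1" using D(2) by (simp only: mult_le_cancel_right_pos)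
      thus "\<bar>G (Suc n) t\<bar> * real H ^ Suc n \<le> 1" by (simp add: G_def x_def)
    qed
    moreover have "f (real N + t) = G 0 t" if "0 \<le> t" for t using D(4) TN that by (simp add: G_def)
    ultimately show "\<exists>G. tame n H G \<and> (\<forall>t\<ge>0. f (real N + t) = G 0 t)" by blast
  qed
qed

section \<open>Subword complexity\<close>

lemma subword_complexity_split:
  assumes "finite (UNIV :: 'a set)"
  shows "subword_complexity (b :: nat \<Rightarrow> 'a) H \<le> M + card ((\<lambda>b. map b [0..<H]) ` {\<lambda>i. b (N + i) | N. M \<le> N})"
proof -
  define w where "w = (\<lambda>N. map (\<lambda>i. b (N + i)) [0..<H])"
  have fin: "finite {xs :: 'a list. length xs = H}" using finite_lists_length_eq[OF assms, of H] by simp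
  have "{w N | N. True} = w ` {..<M} \<union> w ` {M..}" by (auto simp: not_less intro: leI)
  moreover have "w ` {M..} = (\<lambda>b. map b [0..<H]) ` {\<lambda>i. b (N + i) | N. M \<le> N}"
    by (auto simp: w_def)
  moreover have "card (w ` {..<M}) \<le> M" using card_image_le[of "{..<M}" w] by simp
  ultimately show ?thesis unfolding subword_complexity_def w_def
    by (metis (no_types, lifting) add_le_mono1 card_Un_le order_trans)
qed

lemma poly_le_exp_powr:
  assumes "1 \<le> A" "0 < \<delta>" "1 \<le> H"
  shows "A * real H ^ k \<le> exp ((ln A + real k / \<delta>) * real H powr \<delta>)"
proof -
  have Hd: "1 \<le> real H powr \<delta>" using assms by (intro ge_one_powr_ge_zero) auto
  have "ln (A * real H ^ k) = ln A + real k * ln (real H)"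
    using assms by (simp add: ln_mult ln_realpow)
  also have "real k * ln (real H) \<le> real k * (real H powr \<delta> / \<delta>)"
    using assms by (intro mult_left_mono ln_powr_bound) auto
  also have "ln A + real k * (real H powr \<delta> / \<delta>) \<le> ln A * real H powr \<delta> + real k * (real H powr \<delta> / \<delta>)"
    using mult_left_mono[OF Hd, of "ln A"] assms by simp
  finally have "ln (A * real H ^ k) \<le> (ln A + real k / \<delta>) * real H powr \<delta>"
    by (simp add: algebra_simps)
  hence "exp (ln (A * real H ^ k)) \<le> exp ((ln A + real k / \<delta>) * real H powr \<delta>)" by simp
  moreover have "0 < A * real H ^ k" using assms by simp
  ultimately show ?thesis by simp
qed

theorem theoremA:
  fixes a :: "int \<Rightarrow> 'a::finite" and f :: "real \<Rightarrow> real"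
  assumes "bracket_word a"
    and "hardy_field_function f"
    and "polynomial_growth f"
  shows "\<exists>\<delta> C::real. 0 < \<delta> \<and> \<delta> < 1 \<and> 0 < C \<and>
           (\<forall>H::nat. H \<ge> 1 \<longrightarrow>
              real (subword_complexity (\<lambda>n. a \<lfloor>f (real n)\<rfloor>) H) \<le> exp (C * real H powr \<delta>))"
proof -
  obtain g \<pi> where g: "gp g" "finite (range (\<lambda>n::int. g (of_int n)))" "\<And>n. a n = \<pi> (g (of_int n))"
    using assms(1) unfolding bracket_word_def by blast
  obtain n A where A: "1 \<le> A"
    "\<And>N H. 1 \<le> H \<Longrightarrow> A * real H ^ Suc n \<le> real N \<Longrightarrow>
      \<exists>G. tame n H G \<and> (\<forall>t\<ge>0. f (real N + t) = G 0 t)"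
    using hardy_shift_tame[OF assms(2,3)] by blast
  obtain \<eta> C where cov: "0 < \<eta>" "\<eta> \<le> 1" "1 \<le> C"
    "\<And>G H. 1 \<le> H \<Longrightarrow> tame n H G \<Longrightarrow>
       covered \<eta> C H (\<lambda>r q l. \<exists>v. \<forall>i<l. g (of_int \<lfloor>G 0 (real (r + q * i))\<rfloor>) = v)"
    using finite_gp_floor_tame_covered[OF g(1,2), of n] by blast
  define b where "b = (\<lambda>n. a \<lfloor>f (real n)\<rfloor>)"
  define M where "M = (\<lambda>H::nat. nat \<lceil>A * real H ^ Suc n\<rceil>)"
  define W where "W = (\<lambda>H. {\<lambda>i. b (N + i) | N. M H \<le> N})"
  have "covered \<eta> C H (\<lambda>r q l. \<exists>v. \<forall>i<l. w (r + q * i) = v)" if H: "1 \<le> H" and w: "w \<in> W H" for H w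
  proof -
    obtain N where N: "w = (\<lambda>i. b (N + i))" "M H \<le> N" using w by (auto simp: W_def)
    have "A * real H ^ Suc n \<le> real N" using N(2) unfolding M_def by linarith
    from A(2)[OF H this] obtain G where G: "tame n H G" "\<And>t. 0 \<le> t \<Longrightarrow> f (real N + t) = G 0 t" by blast
    have wG: "w i = \<pi> (g (of_int \<lfloor>G 0 (real i)\<rfloor>))" for i
      using G(2)[of "real i"] by (simp add: N(1) b_def g(3))
    show ?thesis
      by (rule covered_mono[OF cov(4)[OF H G(1)]]) (auto simp only: wG)
  qed
  then obtain B where B: "0 \<le> B"
    "\<And>H. 1 \<le> H \<Longrightarrow> real (card ((\<lambda>b. map b [0..<H]) ` W H)) \<le> exp (B * real H powr (1 - \<eta> / 2))"
    using card_words_covered_exp[OF cov(1,3), of W] by blast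
  define \<delta> where "\<delta> = 1 - \<eta> / 2"
  have \<delta>: "0 < \<delta>" "\<delta> < 1" using cov(1,2) by (auto simp: \<delta>_def)
  define K where "K = ln (2 * A) + real (Suc n) / \<delta>"
  have K: "0 \<le> K" using A(1) \<delta> by (simp add: K_def)
  have "real (subword_complexity b H) \<le> exp ((1 + K + B) * real H powr \<delta>)" if H: "1 \<le> H" for H
  proof -
    define x where "x = real H powr \<delta>"
    have x: "1 \<le> x" unfolding x_def using H \<delta> by (intro ge_one_powr_ge_zero) auto
    have "1 \<le> A * real H ^ Suc n"
      using mult_mono[of 1 A 1 "real H ^ Suc n"] A(1) one_le_power[of "real H" "Suc n"] H by simp
    hence "real (M H) \<le> 2 * A * real H ^ Suc n" unfolding M_def by linarith
    also have "\<dots> \<le> exp (K * x)" unfolding K_def x_def using A(1) \<delta> H by (intro poly_le_exp_powr) auto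
    finally have M: "real (M H) \<le> exp (K * x)" .
    have "subword_complexity b H \<le> M H + card ((\<lambda>b. map b [0..<H]) ` W H)"
      unfolding W_def by (rule subword_complexity_split) simp
    hence "real (subword_complexity b H) \<le> exp (K * x) + exp (B * x)"
      using M B(2)[OF H] unfolding \<delta>_def[symmetric] x_def[symmetric] by linarith
    also have "\<dots> \<le> exp ((K + B) * x) + exp ((K + B) * x)"
      using K B(1) x by (intro add_mono) (auto intro: mult_right_mono)
    also have "\<dots> = 2 * exp ((K + B) * x)" by simp
    \<comment> \<open>The factor 2 from adding the two counts is absorbed by exp x, as x \<ge> 1;
      this is the summand 1 of the final constant.\<close>
    also have "\<dots> \<le> exp x * exp ((K + B) * x)"
    proof (rule mult_right_mono)
      show "2 \<le> exp x" using exp_ge_add_one_self[of x] x by linarith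
    qed simp
    also have "\<dots> = exp ((1 + K + B) * x)" by (simp add: algebra_simps flip: exp_add)
    finally show ?thesis by (simp add: x_def)
  qed
  note main = this[unfolded b_def]
  show ?thesis
  proof (rule exI[of _ \<delta>], rule exI[of _ "1 + K + B"], intro conjI allI impI \<delta>)
    show "0 < 1 + K + B" using K B(1) by simp
  qed (rule main)
qed

end
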